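(* Let $n\ge 3$, and let $L_1=L_1(n)$ and $B_n$ be as defined in the context. (i) For every $L>0$ with $L\neq L_1$ there exists a constant $C(n,L)>0$ such that for all metrics of revolution $g$ on $M=[0,L]\times\mathbb{S}^{n-1}$, $$B_n-\sigma_1(M,g)\ge C(n,L).$$ (ii) Moreover, there exists a constant $C(n)>0$, depending only on $n$, such that for all $L>0$ with $L\ne L_1$, all metrics of revolution $g$ on $M=[0,L]\times\mathbb{S}^{n-1}$ and all $0<\delta<\frac{B_n-(n-2)}{2}$, $$|B_n-\sigma_1(M,g)|<\delta \implies |L_1-L|<C(n)\cdot\delta.$$
   Context: Metric of revolution: for $L>0$ and $M=[0,L]\times\mathbb{S}^{n-1}$, a metric of revolution on $M$ is a Riemannian metric of the form $g(r,p) = dr^2 + h^2(r) g_0(p)$, $(r,p)\in[0,L]\times\mathbb{S}^{n-1}$, where $g_0$ is the canonical metric of the unit $(n-1)$-sphere and $h:[0,L]\to(0,\infty)$ is a smooth function satisfying (1) $|h'(r)|\le 1$ for all $r\in[0,L]$ and (2) $h(0)=h(L)=1$. Steklov eigenvalues: for a smooth compact connected Riemannian manifold $(M,g)$ with smooth boundary $\Sigma$, these are the real numbers $\sigma$ for which there is a nonzero harmonic function $f:M\to\mathbb{R}$ with $\partial_\nu f = \sigma f$ on $\Sigma$ ($\nu$ the outward unit normal). They form a sequence $0=\sigma_0(M,g)<\sigma_1(M,g)\le\sigma_2(M,g)\le\dots\nearrow\infty$, repeated according to multiplicity. For $n\ge 3$, $L_1=L_1(n)$ is the unique real positive solution $L$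 of $$\left(1+L/2\right)^{2n-2}-(n-1)\left(1+L/2\right)^n-(n-1)^2\left(1+L/2\right)^{n-2}+n-1=0,$$ and $B_n := \dfrac{(n-2)\left(1+L_1/2\right)^{n-2}}{\left(1+L_1/2\right)^{n-2}-1}$. *)

theory Defs
  imports "HOL-Analysis.Analysis"
begin

subsection \<open>Smooth functions\<close>

primrec C_k_on :: "nat \<Rightarrow> 'a::euclidean_space set \<Rightarrow> ('a \<Rightarrow> real) \<Rightarrow> bool" where
  "C_k_on 0 U f \<longleftrightarrow> continuous_on U f"
| "C_k_on (Suc k) U f \<longleftrightarrow>
     (\<exists>f'. (\<forall>x\<in>U. (f has_derivative f' x) (at x)) \<and> (\<forall>b\<in>Basis. C_k_on k U (\<lambda>x. f' x b)))"

text \<open>A smooth function on a (possibly closed) subset \<open>S\<close> of a Euclidean space is the restriction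
  to \<open>S\<close> of a function that is \<open>C\<^sup>\<infinity>\<close> on an open neighbourhood of \<open>S\<close>. Below such a function is
  always represented by one of its extensions; nothing depends on the choice of the extension.\<close>

definition smooth_near :: "'a::euclidean_space set \<Rightarrow> ('a \<Rightarrow> real) \<Rightarrow> bool" where
  "smooth_near S f \<longleftrightarrow> (\<exists>U. open U \<and> S \<subseteq> U \<and> (\<forall>k. C_k_on k U f))"

subsection \<open>The cylinder \<open>[0,L] \<times> S\<^sup>n\<^sup>-\<^sup>1\<close> and metrics of revolution\<close>

text \<open>The sphere is the unit sphere of \<open>\<real>\<^sup>n\<close>, \<open>n = CARD('n)\<close>, so that the cylinder is embedded in
  \<open>\<real> \<times> \<real>\<^sup>n\<close> and tangent vectors are elements of \<open>\<real> \<times> \<real>\<^sup>n\<close>.\<close>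

type_synonym 'n point = "real \<times> (real ^ 'n)"

definition cylinder :: "real \<Rightarrow> 'n::finite point set" where
  "cylinder L = {0..L} \<times> sphere 0 1"

definition tangent_space :: "'n::finite point \<Rightarrow> 'n point set" where
  "tangent_space z = {v. snd z \<bullet> snd v = 0}"

text \<open>A metric is a function \<open>g\<close> for which \<open>g z\<close> is an inner product on the tangent space at \<open>z\<close>;
  its values elsewhere are irrelevant. The canonical metric of the sphere is the one induced by
  the inner product of \<open>\<real>\<^sup>n\<close>.\<close>

type_synonym 'n metric = "'n point \<Rightarrow> 'n point \<Rightarrow> 'n point \<Rightarrow> real"

definition metric_of_revolution :: "real \<Rightarrow> 'n::finite metric \<Rightarrow> bool" where
  "metric_of_revolution L g \<longleftrightarrow>
     (\<exists>h::real \<Rightarrow> real.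
        smooth_near {0..L} h \<and> (\<forall>r\<in>{0..L}. h r > 0) \<and>
        (\<forall>r\<in>{0..L}. \<bar>deriv h r\<bar> \<le> 1) \<and> h 0 = 1 \<and> h L = 1 \<and>
        (\<forall>z\<in>cylinder L. \<forall>v\<in>tangent_space z. \<forall>w\<in>tangent_space z.
           g z v w = fst v * fst w + (h (fst z))\<^sup>2 * (snd v \<bullet> snd w)))"

subsection \<open>The Laplace-Beltrami operator\<close>

text \<open>The map \<open>x \<mapsto> (|x| - 1, x / |x|)\<close> is a diffeomorphism from the closed annulus
  \<open>1 \<le> |x| \<le> 1 + L\<close> in \<open>\<real>\<^sup>n\<close> onto the cylinder, with inverse \<open>(r, p) \<mapsto> (1 + r) p\<close>. It provides global
  coordinates, in which the Laplace-Beltrami operator is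
  \<open>(det G)\<^sup>-\<^sup>1\<^sup>/\<^sup>2 \<Sum>\<^sub>i \<partial>\<^sub>i ((det G)\<^sup>1\<^sup>/\<^sup>2 \<Sum>\<^sub>j G\<^sup>i\<^sup>j \<partial>\<^sub>j f)\<close>.\<close>

definition param :: "real ^ 'n::finite \<Rightarrow> 'n point" where
  "param x = (norm x - 1, x /\<^sub>R norm x)"

definition partial :: "'n::finite \<Rightarrow> (real ^ 'n \<Rightarrow> real) \<Rightarrow> real ^ 'n \<Rightarrow> real" where
  "partial i u x = frechet_derivative u (at x) (axis i 1)"

definition metric_matrix :: "'n::finite metric \<Rightarrow> real ^ 'n \<Rightarrow> real ^ 'n ^ 'n" where
  "metric_matrix g x =
     (\<chi> i j. g (param x) (frechet_derivative param (at x) (axis i 1))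
                        (frechet_derivative param (at x) (axis j 1)))"

definition laplace_beltrami :: "'n::finite metric \<Rightarrow> ('n point \<Rightarrow> real) \<Rightarrow> real ^ 'n \<Rightarrow> real" where
  "laplace_beltrami g f x =
     (\<Sum>i\<in>UNIV. partial i (\<lambda>y. sqrt (det (metric_matrix g y)) *
        (\<Sum>j\<in>UNIV. matrix_inv (metric_matrix g y) $ i $ j * partial j (f \<circ> param) y)) x)
     / sqrt (det (metric_matrix g x))"

definition harmonic :: "real \<Rightarrow> 'n::finite metric \<Rightarrow> ('n point \<Rightarrow> real) \<Rightarrow> bool" where
  "harmonic L g f \<longleftrightarrow> smooth_near (cylinder L) f \<and>
     (\<forall>x. 1 < norm x \<and> norm x < 1 + L \<longrightarrow> laplace_beltrami g f x = 0)"

subsection \<open>Steklov eigenvalues\<close>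

definition outward_unit_normal :: "real \<Rightarrow> 'n::finite metric \<Rightarrow> 'n point \<Rightarrow> 'n point \<Rightarrow> bool" where
  "outward_unit_normal L g z \<nu> \<longleftrightarrow>
     \<nu> \<in> tangent_space z \<and> g z \<nu> \<nu> = 1 \<and>
     (\<forall>w\<in>tangent_space z. fst w = 0 \<longrightarrow> g z \<nu> w = 0) \<and>
     (fst z = L \<and> fst \<nu> > 0 \<or> fst z = 0 \<and> fst \<nu> < 0)"

definition steklov_eigenfunction ::
  "real \<Rightarrow> 'n::finite metric \<Rightarrow> real \<Rightarrow> ('n point \<Rightarrow> real) \<Rightarrow> bool" where
  "steklov_eigenfunction L g \<sigma> f \<longleftrightarrow>
     harmonic L g f \<and> (\<exists>z\<in>cylinder L. f z \<noteq> 0) \<and>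
     (\<forall>z\<in>{0, L} \<times> sphere 0 1. \<forall>\<nu>. outward_unit_normal L g z \<nu> \<longrightarrow>
        frechet_derivative f (at z) \<nu> = \<sigma> * f z)"

definition lin_indep_on :: "'a set \<Rightarrow> nat \<Rightarrow> (nat \<Rightarrow> 'a \<Rightarrow> real) \<Rightarrow> bool" where
  "lin_indep_on S m f \<longleftrightarrow>
     (\<forall>c. (\<forall>z\<in>S. (\<Sum>i<m. c i * f i z) = 0) \<longrightarrow> (\<forall>i<m. c i = 0))"

text \<open>The eigenvalue of index \<open>k\<close> (starting from \<open>0\<close>) in the nondecreasing enumeration with
  multiplicity is the least \<open>s\<close> such that the eigenvalues \<open>\<le> s\<close> have total multiplicity at
  least \<open>k + 1\<close>.\<close>

definition steklov :: "real \<Rightarrow> 'n::finite metric \<Rightarrow> nat \<Rightarrow> real" where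
  "steklov L g k = Inf {s. \<exists>\<tau> f.
     (\<forall>i<Suc k. steklov_eigenfunction L g (\<tau> i) (f i) \<and> \<tau> i \<le> s) \<and>
     lin_indep_on (cylinder L) (Suc k) f}"

subsection \<open>The critical length and the bound\<close>

definition L1 :: "nat \<Rightarrow> real" where
  "L1 n = (THE L. L > 0 \<and>
     (1 + L / 2) ^ (2 * n - 2) - (real n - 1) * (1 + L / 2) ^ n
       - (real n - 1)\<^sup>2 * (1 + L / 2) ^ (n - 2) + real n - 1 = 0)"

definition B :: "nat \<Rightarrow> real" where
  "B n = (real n - 2) * (1 + L1 n / 2) ^ (n - 2) / ((1 + L1 n / 2) ^ (n - 2) - 1)"

end

theory Submission
  imports Defs
begin

text \<open>Write \<open>x = 1 + L/2\<close>. Two separated families of Steklov eigenfunctions bound \<open>\<sigma>\<^sub>1\<close> from above.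
  The radial one, \<open>a(r)\<close> with \<open>a' = h\<^sup>1\<^sup>-\<^sup>n\<close>, has eigenvalue \<open>2 / \<integral> h\<^sup>1\<^sup>-\<^sup>n\<close>, which is at most
  \<open>F(x) = (n-2) x\<^sup>n\<^sup>-\<^sup>2 / (x\<^sup>n\<^sup>-\<^sup>2 - 1)\<close> since \<open>h(r) \<le> 1 + min(r, L-r)\<close>. For the modes \<open>a(r) v\<^sub>k\<close>, comparing
  the Dirichlet energy with the one of the extremal profile \<open>1 + min(r, L-r)\<close> gives the bound
  \<open>G(x) = (n-1)(x\<^sup>n - 1) / (x\<^sup>n + n - 1)\<close>. As \<open>F\<close> decreases and \<open>G\<close> increases, both strictly, and they
  cross at \<open>L = L\<^sub>1\<close> with common value \<open>B\<^sub>n\<close>, the deficit \<open>B\<^sub>n - min(F, G)\<close> is positive away from \<open>L\<^sub>1\<close>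
  and controls \<open>|L - L\<^sub>1|\<close> linearly. A weak maximum principle shows that no Steklov eigenvalue is
  negative, so that the infimum defining \<open>\<sigma>\<^sub>1\<close> is taken over a set that is bounded below.\<close>

subsection \<open>The two bounds and their crossing\<close>

text \<open>\<open>steklov\<close> is an infimum over families of genuine eigenfunctions, so a trial
  function with a small Rayleigh quotient does not bound it directly: each estimate needs an actual
  smooth eigenfunction. For the modes the radial factor solves a linear system without closed-form
  solution. It is combined from two fundamental solutions, its eigenvalue is a root of a quadratic,
  and only this root is then estimated. No integration over the manifold occurs: energies appear as
  monotone boundary expressions, and signs come from comparison at a maximum. The extremal profile
  glues two flat annuli 1 < \<rho> < x along their outer spheres. A function odd about the gluing
  sphere satisfies a Dirichlet condition there, an even one a Neumann condition. Accordingly F is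
  the radial Steklov-Dirichlet eigenvalue of one annulus, and G the Steklov-Neumann eigenvalue of
  its first mode. The linear rate in (ii) is a slope of F or G. As L grows, F flattens towards n - 2
  and its slope degenerates; the restriction on \<delta> excludes this regime.\<close>

definition radial_bound :: "nat \<Rightarrow> real \<Rightarrow> real" where
  "radial_bound n x = (real n - 2) * x ^ (n - 2) / (x ^ (n - 2) - 1)"

text \<open>Minus the derivative at \<open>\<rho> = 1\<close> of
  \<open>\<rho> + c / \<rho> ^ (n - 1)\<close>, divided by its value there, where
  \<open>c = x ^ n / (n - 1)\<close> makes the derivative vanish at
  \<open>\<rho> = x\<close>.\<close>

definition mode_bound :: "nat \<Rightarrow> real \<Rightarrow> real" where
  "mode_bound n x = (real n - 1) * (x ^ n - 1) / (x ^ n + real n - 1)"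

lemma radial_bound_eq:
  assumes "n \<ge> 3" "x > 1"
  shows "radial_bound n x = (real n - 2) + (real n - 2) / (x ^ (n - 2) - 1)"
proof -
  have "x ^ (n - 2) > 1" using assms by (intro one_less_power) auto
  then show ?thesis by (simp add: radial_bound_def field_simps)
qed

lemma mode_denominator_pos:
  assumes "n \<ge> 3" "(x::real) > 0"
  shows "x ^ n + real n - 1 > 0"
proof -
  have "x ^ n > 0" "real n \<ge> 3" using assms by auto
  then show ?thesis by linarith
qed

lemma mode_bound_eq:
  assumes "n \<ge> 3" "x > 0"
  shows "mode_bound n x = (real n - 1) - real n * (real n - 1) / (x ^ n + real n - 1)"
proof -
  have "x ^ n + real n - 1 > 0" using assms by (rule mode_denominator_pos)
  then show ?thesis by (simp add: mode_bound_def field_simps)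
qed

text \<open>On \<open>[1, \<infinity>)\<close> the map \<open>t ^ m\<close> has slope at least 1, so
  differences of powers may be replaced by differences of arguments. The linear rate of part (ii)
  rests on this.\<close>

lemma power_diff_ge:
  fixes x y :: real
  assumes "1 \<le> x" "x \<le> y" "m \<ge> 1"
  shows "y - x \<le> y ^ m - x ^ m"
proof -
  have "y - x \<le> y ^ Suc k - x ^ Suc k" for k
  proof (induction k)
    case (Suc k)
    have "y ^ Suc k - x ^ Suc k \<le> x * (y ^ Suc k - x ^ Suc k)"
      using assms Suc mult_right_mono[of 1 x "y ^ Suc k - x ^ Suc k"] by auto
    also have "\<dots> \<le> y * y ^ Suc k - x * x ^ Suc k"
      using assms mult_right_mono[of x y "y ^ Suc k"] by (simp add: right_diff_distrib)
    finally show ?case using Suc by simp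
  qed simp
  from this[of "m - 1"] show ?thesis using assms(3) by (simp del: power_Suc)
qed

text \<open>The slope constant involves only the larger endpoint. With \<open>y\<close> fixed at the
  crossing it is uniform in all \<open>x\<close> to its left, so short cylinders need no upper
  restriction on \<delta>.\<close>

lemma mode_bound_diff:
  assumes "n \<ge> 3" "1 < x" "x \<le> y"
  shows "mode_bound n y - mode_bound n x \<ge> real n * (real n - 1) / (y ^ n + real n - 1)\<^sup>2 * (y - x)"
proof -
  define X Y where "X = x ^ n + real n - 1" and "Y = y ^ n + real n - 1"
  have X: "X > 0" using mode_denominator_pos[of n x] assms by (simp add: X_def)
  have XY: "X \<le> Y" unfolding X_def Y_def using assms by (auto intro!: power_mono)
  have d: "Y - X \<ge> y - x" unfolding X_def Y_def using power_diff_ge[of x y n] assms by simp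
  have e: "mode_bound n x = (real n - 1) - real n * (real n - 1) / X"
    "mode_bound n y = (real n - 1) - real n * (real n - 1) / Y"
    using mode_bound_eq[of n x] mode_bound_eq[of n y] assms by (auto simp: X_def Y_def)
  have "mode_bound n y - mode_bound n x = real n * (real n - 1) * (Y - X) / (X * Y)"
    unfolding e using X XY by (simp add: field_simps)
  also have "\<dots> \<ge> real n * (real n - 1) * (y - x) / (Y * Y)"
    using assms X XY d by (intro frac_le mult_left_mono mult_mono mult_nonneg_nonneg) auto
  finally show ?thesis by (simp add: Y_def power2_eq_square)
qed

lemma mode_bound_strict_mono:
  assumes "n \<ge> 3" "1 < x" "x < y"
  shows "mode_bound n x < mode_bound n y"
proof -
  have "y ^ n + real n - 1 > 0" using mode_denominator_pos[of n y] assms by simp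
  then have "real n * (real n - 1) / (y ^ n + real n - 1)\<^sup>2 * (y - x) > 0"
    using assms by (intro mult_pos_pos divide_pos_pos) auto
  then show ?thesis using mode_bound_diff[of n x y] assms by linarith
qed

text \<open>Here the constant decays as \<open>y\<close> grows. A uniform rate to the right of the
  crossing needs an upper bound on \<open>y\<close>, which the restriction on \<delta> will
  supply.\<close>

lemma radial_bound_diff:
  assumes "n \<ge> 3" "1 < x" "x \<le> y"
  shows "radial_bound n x - radial_bound n y
    \<ge> (real n - 2) / ((x ^ (n - 2) - 1) * (y ^ (n - 2) - 1)) * (y - x)"
proof -
  define X Y where "X = x ^ (n - 2) - 1" and "Y = y ^ (n - 2) - 1"
  have X: "X > 0" "Y > 0" using assms one_less_power[of x "n - 2"] one_less_power[of y "n - 2"]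
    by (auto simp: X_def Y_def)
  have d: "Y - X \<ge> y - x" unfolding X_def Y_def using power_diff_ge[of x y "n - 2"] assms by simp
  have "radial_bound n x - radial_bound n y = (real n - 2) / (X * Y) * (Y - X)"
    unfolding radial_bound_eq[OF assms(1,2)] radial_bound_eq[OF assms(1), of y, OF less_le_trans[OF assms(2,3)]]
      X_def[symmetric] Y_def[symmetric] using X by (simp add: field_simps)
  also have "\<dots> \<ge> (real n - 2) / (X * Y) * (y - x)"
    using assms X d by (intro mult_left_mono) auto
  finally show ?thesis by (simp add: X_def Y_def)
qed

lemma radial_bound_strict_antimono:
  assumes "n \<ge> 3" "1 < x" "x < y"
  shows "radial_bound n y < radial_bound n x"
proof -
  have "x ^ (n - 2) > 1" "y ^ (n - 2) > 1" using assms by (auto intro!: one_less_power)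
  then have "(real n - 2) / ((x ^ (n - 2) - 1) * (y ^ (n - 2) - 1)) * (y - x) > 0"
    using assms by (intro mult_pos_pos divide_pos_pos) auto
  then show ?thesis using radial_bound_diff[of n x y] assms by linarith
qed

definition crossing_poly :: "nat \<Rightarrow> real \<Rightarrow> real" where
  "crossing_poly n x = x ^ (2 * n - 2) - (real n - 1) * x ^ n - (real n - 1)\<^sup>2 * x ^ (n - 2) + real n - 1"

text \<open>Cross-multiply. With \<open>X = x ^ n\<close> and \<open>Y = x ^ (n - 2)\<close>, the
  difference \<open>(n-1)(X-1)(Y-1) - (n-2)Y(X+n-1)\<close> equals
  \<open>XY - (n-1)X - (n-1)^2 Y + n - 1\<close>, the two terms in \<open>Y\<close> collecting to
  the square.\<close>

lemma crossing_poly_zero_iff: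
  assumes "n \<ge> 3" "x > 1"
  shows "crossing_poly n x = 0 \<longleftrightarrow> mode_bound n x = radial_bound n x"
proof -
  have p: "x ^ (n - 2) > 1" using assms by (intro one_less_power) auto
  have "x ^ n > 1" using assms by (intro one_less_power) auto
  then have q: "x ^ n + real n - 1 > 0" by simp
  have e: "x ^ (2 * n - 2) = x ^ n * x ^ (n - 2)"
    using assms by (simp add: power_add[symmetric])
  have "mode_bound n x = radial_bound n x \<longleftrightarrow>
      (real n - 1) * (x ^ n - 1) * (x ^ (n - 2) - 1) = (real n - 2) * x ^ (n - 2) * (x ^ n + real n - 1)"
    unfolding mode_bound_def radial_bound_def using p q by (simp add: frac_eq_eq)
  also have "\<dots> \<longleftrightarrow> crossing_poly n x = 0"
    unfolding crossing_poly_def e by (simp add: algebra_simps power2_eq_square)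
  finally show ?thesis ..
qed

lemma crossing_poly_root_exists:
  assumes "n \<ge> 3"
  shows "\<exists>x>1. crossing_poly n x = 0"
proof -
  have "real n - 1 \<ge> 2" using assms by simp
  then have "(real n - 1)\<^sup>2 \<ge> 4" using power_mono[of 2 "real n - 1" 2] by simp
  then have neg: "crossing_poly n 1 < 0" by (simp add: crossing_poly_def)
  have e: "real n ^ (2 * n - 2) = real n ^ n * real n ^ (n - 2)" "real n ^ n = (real n)\<^sup>2 * real n ^ (n - 2)"
    using assms by (simp_all only: power_add[symmetric] le_add_diff_inverse) (simp_all add: power_add[symmetric])
  \<comment> \<open>Evaluation at \<open>x = n\<close>: a factor \<open>n\<close> of the leading
    term absorbs \<open>(n-1) n^n\<close> and leaves \<open>n^n = n^2 n^(n-2)\<close>, which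
    dominates the term with \<open>(n-1)^2\<close>.\<close>
  have "real n ^ (n - 2) \<ge> real n" using assms power_increasing[of 1 "n - 2" "real n"] by simp
  then have "real n ^ n * real n ^ (n - 2) \<ge> real n ^ n * real n"
    by (intro mult_left_mono) auto
  then have "crossing_poly n (real n) \<ge> real n ^ n - (real n - 1)\<^sup>2 * real n ^ (n - 2) + real n - 1"
    unfolding crossing_poly_def e(1) by (simp add: algebra_simps)
  moreover have "(real n - 1)\<^sup>2 \<le> (real n)\<^sup>2" using assms by (intro power_mono) auto
  then have "(real n - 1)\<^sup>2 * real n ^ (n - 2) \<le> real n ^ n"
    unfolding e(2) by (intro mult_right_mono) auto
  ultimately have pos: "crossing_poly n (real n) \<ge> 0" using assms by simp
  have "continuous_on {1..real n} (crossing_poly n)"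
    unfolding crossing_poly_def by (intro continuous_intros)
  then obtain x where "1 \<le> x" "crossing_poly n x = 0"
    using IVT'[of "crossing_poly n" 1 0 "real n"] neg pos assms by auto
  moreover have "x \<noteq> 1" using neg \<open>crossing_poly n x = 0\<close> by auto
  ultimately show ?thesis by (intro exI[of _ x]) auto
qed

lemma L1_crossing:
  assumes "n \<ge> 3"
  shows "L1 n > 0" "mode_bound n (1 + L1 n / 2) = radial_bound n (1 + L1 n / 2)"
proof -
  obtain x where x: "x > 1" "crossing_poly n x = 0" using crossing_poly_root_exists[OF assms] by blast
  \<comment> \<open>Uniqueness follows from the opposite monotonicity of the two bounds; it gives
    the \<open>THE\<close> in \<open>L1\<close> its meaning.\<close>
  have uniq: "y = x" if "y > 1" "crossing_poly n y = 0" for y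
  proof (rule ccontr)
    assume "y \<noteq> x"
    then consider "y < x" | "x < y" by linarith
    then show False
      using mode_bound_strict_mono[OF assms, of x y] radial_bound_strict_antimono[OF assms, of x y]
        mode_bound_strict_mono[OF assms, of y x] radial_bound_strict_antimono[OF assms, of y x]
        crossing_poly_zero_iff[OF assms, of x] crossing_poly_zero_iff[OF assms, of y] x that
      by cases auto
  qed
  have L: "L1 n = 2 * (x - 1)"
    unfolding L1_def crossing_poly_def[symmetric]
  proof (rule the_equality)
    show "2 * (x - 1) > 0 \<and> crossing_poly n (1 + 2 * (x - 1) / 2) = 0"
      using x by (simp add: field_simps del: mult_2)
    show "L = 2 * (x - 1)" if "L > 0 \<and> crossing_poly n (1 + L / 2) = 0" for L
      using uniq[of "1 + L / 2"] that by simp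
  qed
  have "1 + 2 * (x - 1) / 2 = x" by (simp add: diff_divide_distrib)
  then have "L1 n > 0" "1 + L1 n / 2 = x" using x unfolding L by auto
  then show "L1 n > 0" "mode_bound n (1 + L1 n / 2) = radial_bound n (1 + L1 n / 2)"
    using x crossing_poly_zero_iff[OF assms, of x] by auto
qed

lemma B_eq_radial_bound: "B n = radial_bound n (1 + L1 n / 2)"
  by (simp add: B_def radial_bound_def)

text \<open>Only the two upper bounds enter, so metrics and eigenvalue are abstracted to
  \<open>P\<close> and \<open>s\<close> and a problem in one real variable remains. Right of the
  crossing the radial bound yields the deficit, left of it the mode bound.\<close>

lemma stability_from_bounds:
  assumes n: "n \<ge> 3"
    and le: "\<And>L g. L > 0 \<Longrightarrow> P L g \<Longrightarrow> s L g \<le> radial_bound n (1 + L / 2)"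
      "\<And>L g. L > 0 \<Longrightarrow> P L g \<Longrightarrow> s L g \<le> mode_bound n (1 + L / 2)"
  shows "(\<forall>L>0. L \<noteq> L1 n \<longrightarrow> (\<exists>C>0. \<forall>g. P L g \<longrightarrow> B n - s L g \<ge> C)) \<and>
     (\<exists>C>0. \<forall>L>0. L \<noteq> L1 n \<longrightarrow> (\<forall>g. P L g \<longrightarrow>
           (\<forall>\<delta>. 0 < \<delta> \<and> \<delta> < (B n - (real n - 2)) / 2 \<longrightarrow>
              \<bar>B n - s L g\<bar> < \<delta> \<longrightarrow> \<bar>L1 n - L\<bar> < C * \<delta>)))"
proof
  define x1 where "x1 = 1 + L1 n / 2"
  have x1: "x1 > 1" "B n = radial_bound n x1" "B n = mode_bound n x1"
    using L1_crossing[OF n] B_eq_radial_bound[of n] by (auto simp: x1_def)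
  show "\<forall>L>0. L \<noteq> L1 n \<longrightarrow> (\<exists>C>0. \<forall>g. P L g \<longrightarrow> B n - s L g \<ge> C)"
  proof (intro allI impI)
    fix L :: real assume L: "L > 0" "L \<noteq> L1 n"
    then consider "1 + L / 2 > x1" | "1 + L / 2 < x1" by (fastforce simp: x1_def)
    then show "\<exists>C>0. \<forall>g. P L g \<longrightarrow> B n - s L g \<ge> C"
    proof cases
      case 1
      then have "B n - radial_bound n (1 + L / 2) > 0"
        using radial_bound_strict_antimono[OF n x1(1) 1] x1 by simp
      then show ?thesis using le(1)[OF L(1)] by (intro exI[of _ "B n - radial_bound n (1 + L / 2)"]) auto
    next
      case 2
      then have "B n - mode_bound n (1 + L / 2) > 0"
        using mode_bound_strict_mono[OF n _ 2] x1 L by simp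
      then show ?thesis using le(2)[OF L(1)] by (intro exI[of _ "B n - mode_bound n (1 + L / 2)"]) auto
    qed
  qed
  define X where "X = x1 ^ (n - 2) - 1"
  \<comment> \<open>\<open>2 * X\<close> is the largest value of \<open>x ^ (n - 2) - 1\<close> that
    the restriction on \<delta> allows to the right of the crossing. \<open>c2\<close> is the
    constant of \<open>mode_bound_diff\<close> with \<open>y = x1\<close>.\<close>
  define c1 where "c1 = (real n - 2) / (X * (2 * X))"
  define c2 where "c2 = real n * (real n - 1) / (x1 ^ n + real n - 1)\<^sup>2"
  have X: "X > 0" using one_less_power[OF x1(1), of "n - 2"] n by (simp add: X_def)
  have c1: "c1 > 0" using X n by (simp add: c1_def)
  have "x1 ^ n + real n - 1 > 0" using mode_denominator_pos[OF n, of x1] x1(1) by simp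
  then have c2: "c2 > 0" using n unfolding c2_def by (intro divide_pos_pos) auto
  \<comment> \<open>The factor 2 converts \<open>x\<close> into \<open>L = 2 * (x - 1)\<close>; the
    sum serves as a common majorant for the two cases.\<close>
  define C where "C = 2 / c1 + 2 / c2"
  have C: "C > 0" using c1 c2 by (simp add: C_def add_pos_pos)
  have "\<bar>L1 n - L\<bar> < C * \<delta>"
    if L: "L > 0" "L \<noteq> L1 n" "P L g" and \<delta>: "0 < \<delta>" "\<delta> < (B n - (real n - 2)) / 2" "\<bar>B n - s L g\<bar> < \<delta>"
    for L g \<delta>
  proof -
    define x where "x = 1 + L / 2"
    have x: "x > 1" "x \<noteq> x1" "L1 n - L = 2 * (x1 - x)" using L by (auto simp: x_def x1_def)
    have s: "s L g > B n - \<delta>" using \<delta>(3) by (auto simp: abs_if split: if_splits)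
    have less: "\<bar>L1 n - L\<bar> < C * \<delta>" if c: "c * \<bar>x1 - x\<bar> < \<delta>" "c = c1 \<or> c = c2" for c
    proof -
      have cp: "c > 0" using c c1 c2 by auto
      then have "\<bar>x1 - x\<bar> < \<delta> / c" using c by (simp add: field_simps)
      then have "\<bar>L1 n - L\<bar> < 2 / c * \<delta>" using x(3) by (simp add: abs_mult)
      also have "2 / c \<le> C" using c(2) c1 c2 by (auto simp: C_def)
      finally show ?thesis using \<delta>(1) by (meson less_le_trans mult_right_mono less_imp_le)
    qed
    consider "x > x1" | "x < x1" using x by linarith
    then show ?thesis
    proof cases
      case 1
      define Y where "Y = x ^ (n - 2) - 1"
      have Y: "Y > 0" using one_less_power[OF x(1), of "n - 2"] n by (simp add: Y_def)
      have r: "radial_bound n x > B n - \<delta>" using le(1)[OF L(1,3)] s by (simp add: x_def)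
      \<comment> \<open>As \<open>B n - (n - 2) = (n - 2) / X\<close>, a deficit below half of this
        leaves the radial bound above \<open>(n - 2) + (n - 2) / (2 * X)\<close>. This caps
        \<open>Y\<close>, and with it the length of the cylinder.\<close>
      then have "(real n - 2) / Y > (real n - 2) / (2 * X)"
        using \<delta>(2) radial_bound_eq[OF n x(1)] radial_bound_eq[OF n x1(1)] x1(2)
        unfolding X_def[symmetric] Y_def[symmetric] by (simp add: field_simps)
      moreover have "(real n - 2) / Y \<le> (real n - 2) / (2 * X)" if "2 * X < Y"
        using X Y n that by (intro divide_left_mono) auto
      ultimately have "Y \<le> 2 * X" by force
      then have "c1 \<le> (real n - 2) / (X * Y)"
        using X Y n unfolding c1_def by (intro divide_left_mono mult_left_mono) auto
      then have "c1 * (x - x1) \<le> (real n - 2) / (X * Y) * (x - x1)" using 1 by (intro mult_right_mono) auto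
      also have "\<dots> \<le> radial_bound n x1 - radial_bound n x"
        using radial_bound_diff[OF n x1(1), of x] 1 by (simp add: X_def Y_def)
      also have "\<dots> < \<delta>" using r x1(2) by linarith
      finally show ?thesis using less[of c1] 1 by simp
    next
      case 2
      have "c2 * (x1 - x) \<le> mode_bound n x1 - mode_bound n x"
        using mode_bound_diff[OF n x(1), of x1] 2 by (simp add: c2_def)
      also have "\<dots> < \<delta>" using le(2)[OF L(1,3)] s x1(3) by (simp add: x_def)
      finally show ?thesis using less[of c2] 2 by simp
    qed
  qed
  then show "\<exists>C>0. \<forall>L>0. L \<noteq> L1 n \<longrightarrow> (\<forall>g. P L g \<longrightarrow>
           (\<forall>\<delta>. 0 < \<delta> \<and> \<delta> < (B n - (real n - 2)) / 2 \<longrightarrow>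
              \<bar>B n - s L g\<bar> < \<delta> \<longrightarrow> \<bar>L1 n - L\<bar> < C * \<delta>))"
    using C by blast
qed

subsection \<open>Calculus of \<open>C\<^sup>k\<close> functions\<close>

lemma C_k_on_cong:
  assumes "open U" "\<And>x. x \<in> U \<Longrightarrow> f x = g x"
  shows "C_k_on k U f \<longleftrightarrow> C_k_on k U g"
proof (cases k)
  case 0
  then show ?thesis using assms by (auto intro!: continuous_on_cong)
next
  case (Suc m)
  have "(f has_derivative D) (at x) \<longleftrightarrow> (g has_derivative D) (at x)" if "x \<in> U" for x D
    using assms that has_derivative_transform_within_open[of f D x UNIV U g]
      has_derivative_transform_within_open[of g D x UNIV U f] by auto
  then show ?thesis unfolding Suc by auto
qed

lemma C_k_on_subset: "C_k_on k U f \<Longrightarrow> V \<subseteq> U \<Longrightarrow> C_k_on k V f"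
proof (induction k arbitrary: f)
  case 0 then show ?case using continuous_on_subset by auto
next
  case (Suc k)
  then obtain f' where "\<forall>x\<in>U. (f has_derivative f' x) (at x)"
    "\<forall>b\<in>Basis. C_k_on k U (\<lambda>x. f' x b)" by auto
  then show ?case using Suc unfolding C_k_on.simps
    by (intro exI[of _ f'] conjI ballI) auto
qed

lemma C_k_on_SucD: "C_k_on (Suc k) U f \<Longrightarrow> C_k_on k U f"
proof (induction k arbitrary: f)
  case 0
  then show ?case
    by (auto intro!: continuous_at_imp_continuous_on dest: has_derivative_continuous)
next
  case (Suc k)
  then obtain f' where f': "\<forall>x\<in>U. (f has_derivative f' x) (at x)"
    "\<forall>b\<in>Basis. C_k_on (Suc k) U (\<lambda>x. f' x b)" using C_k_on.simps(2)[of "Suc k"] by blast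
  then show ?case using Suc.IH C_k_on.simps(2)[of k] by blast
qed

lemma C_k_on_has_derivative:
  assumes "C_k_on (Suc k) U f" "x \<in> U"
  shows "(f has_derivative frechet_derivative f (at x)) (at x)"
proof -
  have "f differentiable (at x)" using assms by (auto simp: differentiable_def)
  then show ?thesis by (simp add: frechet_derivative_works)
qed

lemma C_k_on_frechet:
  assumes "open U" "C_k_on (Suc k) U f" "b \<in> Basis"
  shows "C_k_on k U (\<lambda>x. frechet_derivative f (at x) b)"
proof -
  obtain f' where f': "\<forall>x\<in>U. (f has_derivative f' x) (at x)"
    "\<forall>b\<in>Basis. C_k_on k U (\<lambda>x. f' x b)" using assms by auto
  then have "f' x = frechet_derivative f (at x)" if "x \<in> U" for x
    using that frechet_derivative_at by blast
  then show ?thesis using f' assms C_k_on_cong[of U "\<lambda>x. f' x b"] by fastforce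
qed

lemma C_k_on_const: "C_k_on k U (\<lambda>x. c)"
proof (induction k arbitrary: c)
  case (Suc k)
  then show ?case unfolding C_k_on.simps by (intro exI[of _ "\<lambda>x y. 0"]) auto
qed auto

lemma C_k_on_bounded_linear:
  assumes "bounded_linear f"
  shows "C_k_on k U f"
proof (cases k)
  case 0 then show ?thesis using assms by (auto intro: linear_continuous_on)
next
  case (Suc m)
  then show ?thesis using bounded_linear_imp_has_derivative[OF assms]
    by (auto intro!: exI[of _ "\<lambda>x. f"] C_k_on_const)
qed

lemma C_k_on_add:
  assumes "C_k_on k U f" "C_k_on k U g"
  shows "C_k_on k U (\<lambda>x. f x + g x)"
  using assms
proof (induction k arbitrary: f g)
  case 0 then show ?case by (auto intro: continuous_intros)
next
  case (Suc k)
  then obtain f' g' where "\<forall>x\<in>U. (f has_derivative f' x) (at x)"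
    "\<forall>b\<in>Basis. C_k_on k U (\<lambda>x. f' x b)" "\<forall>x\<in>U. (g has_derivative g' x) (at x)"
    "\<forall>b\<in>Basis. C_k_on k U (\<lambda>x. g' x b)" by auto
  with Suc.IH show ?case
    unfolding C_k_on.simps
    by (intro exI[of _ "\<lambda>x y. f' x y + g' x y"] conjI ballI has_derivative_add) auto
qed

lemma C_k_on_mult:
  assumes "C_k_on k U f" "C_k_on k U g"
  shows "C_k_on k U (\<lambda>x. f x * g x)"
  using assms
proof (induction k arbitrary: f g)
  case 0 then show ?case by (auto intro: continuous_intros)
next
  case (Suc k)
  note fg = Suc.prems[THEN C_k_on_SucD]
  obtain f' g' where "\<forall>x\<in>U. (f has_derivative f' x) (at x)"
    "\<forall>b\<in>Basis. C_k_on k U (\<lambda>x. f' x b)" "\<forall>x\<in>U. (g has_derivative g' x) (at x)"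
    "\<forall>b\<in>Basis. C_k_on k U (\<lambda>x. g' x b)" using Suc.prems by auto
  then show ?case using Suc.IH fg
    unfolding C_k_on.simps
    by (intro exI[of _ "\<lambda>x y. f x * g' x y + f' x y * g x"] conjI ballI has_derivative_mult C_k_on_add) auto
qed

lemma C_k_on_sum:
  assumes "\<And>i. i \<in> I \<Longrightarrow> C_k_on k U (f i)"
  shows "C_k_on k U (\<lambda>x. \<Sum>i\<in>I. f i x)"
  using assms by (induction I rule: infinite_finite_induct) (simp_all add: C_k_on_add C_k_on_const)

lemma C_k_on_power: "C_k_on k U f \<Longrightarrow> C_k_on k U (\<lambda>x. f x ^ m)"
  by (induction m) (simp_all add: C_k_on_mult C_k_on_const)

text \<open>The derivative of \<open>1 / f\<close> is a product of \<open>f'\<close> with two copies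
  of \<open>1 / f\<close>, and these have the required order by the induction hypothesis.\<close>

lemma C_k_on_inverse:
  assumes "C_k_on k U f" "\<And>x. x \<in> U \<Longrightarrow> f x \<noteq> 0"
  shows "C_k_on k U (\<lambda>x. inverse (f x))"
  using assms
proof (induction k)
  case 0 then show ?case by (auto intro: continuous_intros)
next
  case (Suc k)
  have i: "C_k_on k U (\<lambda>x. inverse (f x))" using Suc C_k_on_SucD by blast
  obtain f' where "\<forall>x\<in>U. (f has_derivative f' x) (at x)"
    "\<forall>b\<in>Basis. C_k_on k U (\<lambda>x. f' x b)" using Suc.prems by auto
  then show ?case using Suc.prems(2) i unfolding C_k_on.simps
    by (intro exI[of _ "\<lambda>x y. - 1 * (inverse (f x) * f' x y * inverse (f x))"] conjI ballI
      C_k_on_mult C_k_on_const) (auto intro!: derivative_eq_intros)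
qed

text \<open>Componentwise chain rule: a directional derivative is a sum of products of derivatives
  of the components of \<phi> with partial derivatives of \<open>f\<close> composed with \<phi>. The
  induction keeps \<open>f\<close> arbitrary in order to reach the latter.\<close>

lemma C_k_on_compose:
  fixes \<phi> :: "'b::euclidean_space \<Rightarrow> 'a::euclidean_space"
  assumes "open U" "C_k_on k U f" "\<And>b. b \<in> Basis \<Longrightarrow> C_k_on k V (\<lambda>x. \<phi> x \<bullet> b)" "\<phi> ` V \<subseteq> U"
  shows "C_k_on k V (\<lambda>x. f (\<phi> x))"
  using assms(2,3)
proof (induction k arbitrary: f)
  case 0
  have "\<forall>b\<in>Basis. continuous_on V (\<lambda>x. \<phi> x \<bullet> b)" using 0(2) by auto
  then have "continuous_on V \<phi>" by (rule iffD2[OF continuous_on_componentwise])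
  then show ?case using 0(1) assms(4) continuous_on_compose2[of U f V \<phi>] by auto
next
  case (Suc k)
  have \<phi>: "C_k_on k V (\<lambda>x. \<phi> x \<bullet> b)" if "b \<in> Basis" for b
    using Suc.prems(2)[OF that] C_k_on_SucD by blast
  obtain f' where f': "\<forall>x\<in>U. (f has_derivative f' x) (at x)"
    "\<forall>b\<in>Basis. C_k_on k U (\<lambda>x. f' x b)" using Suc.prems by auto
  obtain p where p: "\<And>b x. b \<in> Basis \<Longrightarrow> x \<in> V \<Longrightarrow> ((\<lambda>x. \<phi> x \<bullet> b) has_derivative p b x) (at x)"
    "\<And>b c. b \<in> Basis \<Longrightarrow> c \<in> Basis \<Longrightarrow> C_k_on k V (\<lambda>x. p b x c)"
    using Suc.prems(2) by simp metis
  define \<phi>' where "\<phi>' x y = (\<Sum>b\<in>Basis. p b x y *\<^sub>R b)" for x y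
  have \<phi>': "(\<phi> has_derivative \<phi>' x) (at x)" if "x \<in> V" for x
  proof (subst has_derivative_componentwise_within, intro ballI)
    fix b :: 'a assume b: "b \<in> Basis"
    have "\<phi>' x y \<bullet> b = p b x y" for y unfolding \<phi>'_def
      using b by (simp add: inner_sum_left inner_Basis if_distrib sum.delta cong: if_cong)
    then show "((\<lambda>x. \<phi> x \<bullet> b) has_derivative (\<lambda>y. \<phi>' x y \<bullet> b)) (at x)"
      using p(1)[OF b that] by simp
  qed
  have "((\<lambda>x. f (\<phi> x)) has_derivative (\<lambda>y. \<Sum>b\<in>Basis. p b x y * f' (\<phi> x) b)) (at x)" if "x \<in> V" for x
  proof -
    have D: "(f has_derivative f' (\<phi> x)) (at (\<phi> x))" using f' that assms(4) by auto
    then have "linear (f' (\<phi> x))" using has_derivative_linear by blast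
    then have "f' (\<phi> x) (\<phi>' x y) = (\<Sum>b\<in>Basis. p b x y * f' (\<phi> x) b)" for y
      unfolding \<phi>'_def by (simp add: linear_sum linear_scale)
    moreover have "((\<lambda>x. f (\<phi> x)) has_derivative (\<lambda>y. f' (\<phi> x) (\<phi>' x y))) (at x)"
      using has_derivative_compose[OF \<phi>'[OF that] D] .
    ultimately show ?thesis by simp
  qed
  moreover have "C_k_on k V (\<lambda>x. \<Sum>b\<in>Basis. p b x c * f' (\<phi> x) b)" if "c \<in> Basis" for c
  proof (intro C_k_on_sum C_k_on_mult)
    fix b :: 'a assume b: "b \<in> Basis"
    show "C_k_on k V (\<lambda>x. p b x c)" using p(2)[OF b that] .
    show "C_k_on k V (\<lambda>x. f' (\<phi> x) b)" using Suc.IH[of "\<lambda>x. f' x b"] f'(2) b \<phi> by blast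
  qed
  ultimately show ?case unfolding C_k_on.simps
    by (intro exI[of _ "\<lambda>x y. \<Sum>b\<in>Basis. p b x y * f' (\<phi> x) b"] conjI ballI)
qed

lemma C_k_on_norm: 
  assumes "0 \<notin> U" shows "C_k_on k U (norm :: 'a::euclidean_space \<Rightarrow> real)"
proof (induction k)
  case 0 then show ?case by (auto intro: continuous_intros)
next
  case (Suc k)
  have "((norm :: 'a \<Rightarrow> real) has_derivative (\<lambda>y. (x \<bullet> y) * inverse (norm x))) (at x)" if "x \<in> U" for x
    using has_derivative_norm[of x] that assms
    by (auto simp: sgn_div_norm inner_commute divide_inverse mult.commute)
  moreover have "C_k_on k U (\<lambda>x. (x \<bullet> b) * inverse (norm x))" for b
    using Suc assms
    by (intro C_k_on_mult C_k_on_inverse C_k_on_bounded_linear[OF bounded_linear_inner_left]) auto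
  ultimately show ?case unfolding C_k_on.simps
    by (intro exI[of _ "\<lambda>x y. (x \<bullet> y) * inverse (norm x)"] conjI ballI)
qed

lemma C_k_on_SucI_real:
  fixes f :: "real \<Rightarrow> real"
  assumes "\<And>x. x \<in> U \<Longrightarrow> (f has_real_derivative f' x) (at x)" "C_k_on k U f'"
  shows "C_k_on (Suc k) U f"
  unfolding C_k_on.simps
proof (intro exI[of _ "\<lambda>x y. f' x * y"] conjI ballI)
  show "(f has_derivative (*) (f' x)) (at x)" if "x \<in> U" for x
    using assms(1)[OF that] by (simp add: has_field_derivative_def)
  show "C_k_on k U (\<lambda>x. f' x * b)" if "b \<in> Basis" for b
    using assms(2) that by simp
qed

lemma C_k_on_deriv:
  fixes f :: "real \<Rightarrow> real"
  assumes "open U" "C_k_on (Suc k) U f"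
  shows "C_k_on k U (deriv f)" "\<And>x. x \<in> U \<Longrightarrow> (f has_real_derivative deriv f x) (at x)"
proof -
  obtain f' where f': "\<forall>x\<in>U. (f has_derivative f' x) (at x)" "C_k_on k U (\<lambda>x. f' x 1)"
    using assms by auto
  have d: "(f has_real_derivative f' x 1) (at x)" if "x \<in> U" for x
  proof (rule has_derivative_imp_has_field_derivative)
    show D: "(f has_derivative f' x) (at x)" using f' that by blast
    show "y * f' x 1 = f' x y" for y
      using linear_scale[OF has_derivative_linear[OF D], of y 1] by simp
  qed
  then show "(f has_real_derivative deriv f x) (at x)" if "x \<in> U" for x
    using that DERIV_imp_deriv by fastforce
  have "deriv f x = f' x 1" if "x \<in> U" for x by (rule DERIV_imp_deriv[OF d[OF that]])
  then show "C_k_on k U (deriv f)" using f'(2) C_k_on_cong[OF assms(1), of "deriv f" "\<lambda>x. f' x 1" k] by simp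
qed

subsection \<open>Linear systems of ordinary differential equations\<close>

lemma global_antiderivative:
  fixes f :: "real \<Rightarrow> real"
  assumes "continuous_on UNIV f"
  shows "\<exists>g. g 0 = 0 \<and> (\<forall>t. (g has_real_derivative f t) (at t))"
proof -
  have "\<exists>F. \<forall>x::real. -\<infinity> < ereal x \<longrightarrow> ereal x < \<infinity> \<longrightarrow> (F has_vector_derivative f x) (at x)"
    using assms by (intro einterval_antiderivative) (auto simp: continuous_on_eq_continuous_at)
  then obtain F where F: "\<And>x. (F has_real_derivative f x) (at x)"
    by (auto simp: has_real_derivative_iff_has_vector_derivative)
  then have "((\<lambda>x. F x - F 0) has_real_derivative f x) (at x)" for x
    by (auto intro!: derivative_eq_intros)
  then show ?thesis by (intro exI[of _ "\<lambda>x. F x - F 0"]) auto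
qed

text \<open>One integration gains the factor \<open>|t| / (k + 1)\<close>, which accumulates to the
  factorial of Picard iteration. Both signs of \<open>t\<close> occur because the initial point 0 is
  interior; negative times reduce to positive ones by reflection.\<close>

lemma abs_le_integral_power:
  fixes g :: "real \<Rightarrow> real"
  assumes "g 0 = 0" "\<And>s. (g has_real_derivative g' s) (at s)" "\<And>s. \<bar>g' s\<bar> \<le> K * \<bar>s\<bar> ^ k"
  shows "\<bar>g t\<bar> \<le> K * \<bar>t\<bar> ^ Suc k / real (Suc k)"
proof -
  have pos: "\<bar>G t\<bar> \<le> K * t ^ Suc k / real (Suc k)"
    if G: "G 0 = 0" "\<And>s. (G has_real_derivative G' s) (at s)" "\<And>s. \<bar>G' s\<bar> \<le> K * \<bar>s\<bar> ^ k" "t \<ge> 0"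
    for G G' t
  proof -
    have d: "((\<lambda>s. K * s ^ Suc k / real (Suc k)) has_real_derivative K * s ^ k) (at s)" for s
      by (rule derivative_eq_intros refl | simp)+
    have b: "\<bar>G' s\<bar> \<le> K * s ^ k" if "0 \<le> s" for s using G(3)[of s] that by simp
    have "K * 0 ^ Suc k / real (Suc k) - G 0 \<le> K * t ^ Suc k / real (Suc k) - G t"
    proof (rule DERIV_nonneg_imp_nondecreasing[OF \<open>t \<ge> 0\<close>])
      fix s assume "0 \<le> s" "s \<le> t"
      then show "\<exists>y. ((\<lambda>s. K * s ^ Suc k / real (Suc k) - G s) has_real_derivative y) (at s) \<and> 0 \<le> y"
        using b[of s] by (intro exI[of _ "K * s ^ k - G' s"] conjI DERIV_diff d G) auto
    qed
    moreover have "K * 0 ^ Suc k / real (Suc k) + G 0 \<le> K * t ^ Suc k / real (Suc k) + G t"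
    proof (rule DERIV_nonneg_imp_nondecreasing[OF \<open>t \<ge> 0\<close>])
      fix s assume "0 \<le> s" "s \<le> t"
      then show "\<exists>y. ((\<lambda>s. K * s ^ Suc k / real (Suc k) + G s) has_real_derivative y) (at s) \<and> 0 \<le> y"
        using b[of s] by (intro exI[of _ "K * s ^ k + G' s"] conjI DERIV_add d G) auto
    qed
    ultimately show ?thesis using G(1) by auto
  qed
  show ?thesis
  proof (cases "t \<ge> 0")
    case True
    then show ?thesis using pos[of g g' t] assms by simp
  next
    case False
    have "((\<lambda>s. g (- s)) has_real_derivative - g' (- s)) (at s)" for s
      using DERIV_chain'[OF DERIV_minus[OF DERIV_ident] assms(2)[of "- s"]] by simp
    then show ?thesis
      using pos[of "\<lambda>s. g (- s)" "\<lambda>s. - g' (- s)" "- t"] False assms(1) assms(3)[of "- s" for s] by simp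
  qed
qed

text \<open>Picard iteration: the \<open>k\<close>-th correction is bounded by \<open>C (M |t|)\<^sup>k / k!\<close>.\<close>

lemma linear_system_exists:
  fixes \<alpha> \<beta> :: "real \<Rightarrow> real"
  assumes cont: "continuous_on UNIV \<alpha>" "continuous_on UNIV \<beta>"
    and bound: "\<And>t. \<bar>\<alpha> t\<bar> \<le> M" "\<And>t. \<bar>\<beta> t\<bar> \<le> M"
  shows "\<exists>a p. a 0 = a0 \<and> p 0 = p0 \<and>
    (\<forall>t. (a has_real_derivative \<alpha> t * p t) (at t) \<and> (p has_real_derivative \<beta> t * a t) (at t))"
proof -
  define J where "J f = (SOME g. g 0 = 0 \<and> (\<forall>t. (g has_real_derivative f t) (at t)))"
    for f :: "real \<Rightarrow> real"
  have J: "J f 0 = 0" "(J f has_real_derivative f t) (at t)" if "continuous_on UNIV f" for f t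
    using someI_ex[OF global_antiderivative[OF that]] unfolding J_def by blast+
  \<comment> \<open>\<open>y k\<close> is the \<open>k\<close>-th correction, not the
    \<open>k\<close>-th iterate: the solution is the sum of all of them. Only \<open>k = 0\<close>
    carries the initial values, since \<open>J\<close> yields functions vanishing at 0.\<close>
  define y where "y k = ((\<lambda>(a, p). (J (\<lambda>t. \<alpha> t * p t), J (\<lambda>t. \<beta> t * a t))) ^^ k)
    (\<lambda>t. a0, \<lambda>t. p0)" for k
  define u where "u k = fst (y k)" for k
  define v where "v k = snd (y k)" for k
  have rec: "u 0 = (\<lambda>t. a0)" "v 0 = (\<lambda>t. p0)"
    "u (Suc k) = J (\<lambda>t. \<alpha> t * v k t)" "v (Suc k) = J (\<lambda>t. \<beta> t * u k t)" for k
    by (auto simp: u_def v_def y_def split_beta)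
  have uv: "continuous_on UNIV (u k) \<and> continuous_on UNIV (v k)" for k
  proof (induction k)
    case 0 then show ?case by (simp add: rec)
  next
    case (Suc k)
    then have "continuous_on UNIV (\<lambda>t. \<alpha> t * v k t)" "continuous_on UNIV (\<lambda>t. \<beta> t * u k t)"
      using cont by (auto intro!: continuous_intros)
    then show ?case unfolding rec
      by (meson J(2) DERIV_isCont continuous_at_imp_continuous_on)
  qed
  then have c: "continuous_on UNIV (\<lambda>t. \<alpha> t * v k t)" "continuous_on UNIV (\<lambda>t. \<beta> t * u k t)" for k
    using cont by (auto intro!: continuous_intros)
  define C where "C = \<bar>a0\<bar> + \<bar>p0\<bar>"
  have M: "M \<ge> 0" using bound(1)[of 0] by linarith
  have C: "C \<ge> 0" by (simp add: C_def)
  have bd: "\<bar>u k t\<bar> \<le> C * M ^ k / fact k * \<bar>t\<bar> ^ k \<and> \<bar>v k t\<bar> \<le> C * M ^ k / fact k * \<bar>t\<bar> ^ k" for k t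
  proof (induction k arbitrary: t)
    case 0 then show ?case by (simp add: rec C_def)
  next
    case (Suc k)
    have b: "\<bar>\<alpha> s * v k s\<bar> \<le> (M * (C * M ^ k / fact k)) * \<bar>s\<bar> ^ k"
      "\<bar>\<beta> s * u k s\<bar> \<le> (M * (C * M ^ k / fact k)) * \<bar>s\<bar> ^ k" for s
      using mult_mono[OF bound(1)[of s] conjunct2[OF Suc.IH[of s]]]
        mult_mono[OF bound(2)[of s] conjunct1[OF Suc.IH[of s]]] M by (auto simp: abs_mult mult.assoc)
    have e: "(M * (C * M ^ k / fact k)) * \<bar>t\<bar> ^ Suc k / real (Suc k) = C * M ^ Suc k / fact (Suc k) * \<bar>t\<bar> ^ Suc k"
      by (simp add: field_simps)
    show ?case
      using abs_le_integral_power[OF J(1)[OF c(1)] J(2)[OF c(1)] b(1), of t]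
        abs_le_integral_power[OF J(1)[OF c(2)] J(2)[OF c(2)] b(2), of t] unfolding e rec by blast
  qed
  have summ: "summable (\<lambda>k. C * M ^ k / fact k * R ^ k)" for R
    using summable_mult[OF summable_exp_generic[of "M * R"], of C]
    by (simp add: power_mult_distrib field_simps scaleR_conv_of_real)
  have sw: "summable (\<lambda>k. w k t)"
    if "\<And>k. \<bar>w k t\<bar> \<le> C * M ^ k / fact k * \<bar>t\<bar> ^ k" for w :: "nat \<Rightarrow> real \<Rightarrow> real" and t
    using summable_comparison_test[OF _ summ[of "\<bar>t\<bar>"], of "\<lambda>k. w k t"] that by auto
  have deriv: "((\<lambda>t. \<Sum>k. w k t) has_real_derivative \<gamma> t * (\<Sum>k. z k t)) (at t)"
    if w: "w 0 = (\<lambda>t. w0)" "\<And>k t. (w (Suc k) has_real_derivative \<gamma> t * z k t) (at t)"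
      "\<And>k. w (Suc k) 0 = 0"
      and z: "\<And>k t. \<bar>z k t\<bar> \<le> C * M ^ k / fact k * \<bar>t\<bar> ^ k" and \<gamma>: "\<And>t. \<bar>\<gamma> t\<bar> \<le> M"
    for w z :: "nat \<Rightarrow> real \<Rightarrow> real" and \<gamma> w0 t
  proof -
    \<comment> \<open>The term of index 0 is constant, so the series of derivatives is the series of
      \<open>\<gamma> * z\<close> shifted by one.\<close>
    define w' where "w' k s = (case k of 0 \<Rightarrow> 0 | Suc j \<Rightarrow> \<gamma> s * z j s)" for k s
    define R where "R = \<bar>t\<bar> + 1"
    have "((\<lambda>t. \<Sum>k. w k t) has_real_derivative (\<Sum>k. w' k t)) (at t)"
    proof (rule has_field_derivative_series'(2)[of "ball 0 R" w w' 0])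
      show "(w k has_real_derivative w' k s) (at s within ball 0 R)" for k s
        using w(1,2) by (cases k) (auto simp: w'_def intro: has_field_derivative_at_within)
      define b where "b k = (case k of 0 \<Rightarrow> 0 | Suc j \<Rightarrow> M * (C * M ^ j / fact j * R ^ j))" for k
      have "norm (w' k s) \<le> b k" if "s \<in> ball 0 R" for k s
      proof (cases k)
        case (Suc j)
        have "\<bar>s\<bar> ^ j \<le> R ^ j" using that by (auto intro!: power_mono)
        then have "C * M ^ j / fact j * \<bar>s\<bar> ^ j \<le> C * M ^ j / fact j * R ^ j"
          using C M by (intro mult_left_mono) auto
        then have "\<bar>z j s\<bar> \<le> C * M ^ j / fact j * R ^ j" using z[of j s] by linarith
        then have "\<bar>\<gamma> s\<bar> * \<bar>z j s\<bar> \<le> M * (C * M ^ j / fact j * R ^ j)"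
          using mult_mono[OF \<gamma>[of s]] M by (meson abs_ge_zero)
        then show ?thesis by (simp add: Suc w'_def b_def abs_mult)
      qed (simp add: w'_def b_def)
      moreover have "summable b"
        unfolding summable_Suc_iff[of b, symmetric] unfolding b_def nat.case by (rule summable_mult[OF summ])
      ultimately show "uniformly_convergent_on (ball 0 R) (\<lambda>n s. \<Sum>i<n. w' i s)"
        by (intro Weierstrass_m_test') auto
      show "summable (\<lambda>k. w k 0)"
        unfolding summable_Suc_iff[of "\<lambda>k. w k 0", symmetric] by (simp add: w(3))
    qed (auto simp: R_def)
    moreover have "(\<Sum>k. w' k t) = \<gamma> t * (\<Sum>k. z k t)"
    proof -
      have s: "summable (\<lambda>k. z k t)" using sw z by blast
      then have "summable (\<lambda>k. w' (Suc k) t)" by (simp add: w'_def summable_mult)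
      then have "summable (\<lambda>k. w' k t)" by (subst (asm) summable_Suc_iff)
      then have "(\<Sum>k. w' k t) = (\<Sum>k. w' (Suc k) t)"
        using suminf_split_head[of "\<lambda>k. w' k t"] by (simp add: w'_def)
      then show ?thesis using s by (simp add: w'_def suminf_mult)
    qed
    ultimately show ?thesis by simp
  qed
  have z0: "(\<Sum>k. w k 0) = w0" if "w 0 0 = w0" "\<And>k. w (Suc k) 0 = 0"
    for w :: "nat \<Rightarrow> real \<Rightarrow> real" and w0
  proof -
    have "(\<Sum>k. w k 0) = (\<Sum>k\<in>{0}. w k 0)"
      using that(2) by (intro suminf_finite) (auto simp: gr0_conv_Suc)
    then show ?thesis using that(1) by simp
  qed
  show ?thesis
  proof (intro exI conjI allI)
    show "(\<Sum>k. u k 0) = a0" "(\<Sum>k. v k 0) = p0"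
      using J(1) c by (auto intro!: z0 simp: rec)
    show "((\<lambda>t. \<Sum>k. u k t) has_real_derivative \<alpha> t * (\<Sum>k. v k t)) (at t)" for t
      by (rule deriv) (use J(1)[OF c(1)] J(2)[OF c(1)] rec bd bound in auto)
    show "((\<lambda>t. \<Sum>k. v k t) has_real_derivative \<beta> t * (\<Sum>k. u k t)) (at t)" for t
      by (rule deriv) (use J(1)[OF c(2)] J(2)[OF c(2)] rec bd bound in auto)
  qed
qed

text \<open>Freezing the coefficients at their endpoint values outside \<open>[l, r]\<close> makes
  them bounded and continuous on the whole line and leaves the system unchanged inside.\<close>

lemma linear_system_on_interval:
  fixes \<alpha> \<beta> :: "real \<Rightarrow> real"
  assumes cont: "continuous_on {l..r} \<alpha>" "continuous_on {l..r} \<beta>" and "l < 0" "0 < r"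
  shows "\<exists>a p. a 0 = a0 \<and> p 0 = p0 \<and>
    (\<forall>t\<in>{l<..<r}. (a has_real_derivative \<alpha> t * p t) (at t) \<and> (p has_real_derivative \<beta> t * a t) (at t))"
proof -
  define c where "c t = max l (min r t)" for t
  have c: "c t \<in> {l..r}" "t \<in> {l<..<r} \<Longrightarrow> c t = t" for t using assms(3,4) by (auto simp: c_def)
  have cc: "continuous_on UNIV c" unfolding c_def by (intro continuous_intros)
  have "compact ((\<lambda>t. \<bar>\<alpha> t\<bar> + \<bar>\<beta> t\<bar>) ` {l..r})"
    using cont by (intro compact_continuous_image continuous_intros) auto
  then have "bounded ((\<lambda>t. \<bar>\<alpha> t\<bar> + \<bar>\<beta> t\<bar>) ` {l..r})" by (rule compact_imp_bounded)
  then obtain M where "\<And>t. t \<in> {l..r} \<Longrightarrow> norm (\<bar>\<alpha> t\<bar> + \<bar>\<beta> t\<bar>) \<le> M"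
    unfolding bounded_iff by blast
  then have M: "\<bar>\<alpha> t\<bar> \<le> M" "\<bar>\<beta> t\<bar> \<le> M" if "t \<in> {l..r}" for t
    using that by (force simp: abs_if split: if_splits)+
  have "continuous_on UNIV (\<lambda>t. \<alpha> (c t))" "continuous_on UNIV (\<lambda>t. \<beta> (c t))"
    using cont cc c(1) by (auto intro!: continuous_on_compose2[of "{l..r}" _ UNIV c])
  then obtain a p where "a 0 = a0" "p 0 = p0"
    "\<And>t. (a has_real_derivative \<alpha> (c t) * p t) (at t)" "\<And>t. (p has_real_derivative \<beta> (c t) * a t) (at t)"
    using linear_system_exists[of "\<lambda>t. \<alpha> (c t)" "\<lambda>t. \<beta> (c t)" M a0 p0] M[OF c(1)] by auto
  then show ?thesis using c(2) by metis
qed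

text \<open>Bootstrapping: the right-hand sides are as smooth as the solution, so each round gains
  one derivative.\<close>

lemma C_k_on_linear_system:
  fixes a p \<alpha> \<beta> :: "real \<Rightarrow> real"
  assumes "\<And>t. t \<in> U \<Longrightarrow> (a has_real_derivative \<alpha> t * p t) (at t)"
    "\<And>t. t \<in> U \<Longrightarrow> (p has_real_derivative \<beta> t * a t) (at t)"
    "\<And>k. C_k_on k U \<alpha>" "\<And>k. C_k_on k U \<beta>"
  shows "C_k_on k U a \<and> C_k_on k U p"
proof (induction k)
  case 0
  then show ?case using assms(1,2)
    by (auto intro!: continuous_at_imp_continuous_on dest: DERIV_isCont)
next
  case (Suc k)
  then have "C_k_on k U (\<lambda>t. \<alpha> t * p t)" "C_k_on k U (\<lambda>t. \<beta> t * a t)"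
    using assms(3,4)[of k] by (simp_all add: C_k_on_mult)
  then show ?case using assms(1,2)[THEN C_k_on_SucI_real] by blast
qed

subsection \<open>The metric in annular coordinates\<close>

text \<open>For a unit vector \<open>x\<close>, the symmetric matrix with eigenvalue 1 along
  \<open>x\<close> and \<open>c\<close> on the orthogonal complement.\<close>

definition stretch_matrix :: "real \<Rightarrow> real ^ 'n \<Rightarrow> real ^ 'n::finite ^ 'n" where
  "stretch_matrix c x = (\<chi> i j. x $ i * x $ j + c * ((if i = j then 1 else 0) - x $ i * x $ j))"

lemma sum_component_sq: "norm (x :: real ^ 'n::finite) = 1 \<Longrightarrow> (\<Sum>i\<in>UNIV. x $ i * x $ i) = 1"
  by (metis inner_vec_def inner_real_def norm_eq_1)

text \<open>Both factors combine the same two complementary orthogonal projections, so the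
  coefficients simply multiply.\<close>

lemma stretch_matrix_mult:
  fixes x :: "real ^ 'n::finite"
  assumes "norm x = 1"
  shows "stretch_matrix c x ** stretch_matrix d x = stretch_matrix (c * d) x"
proof -
  define \<delta> :: "'n \<Rightarrow> 'n \<Rightarrow> real" where "\<delta> i j = (if i = j then 1 else 0)" for i j
  have d: "(\<Sum>k\<in>UNIV. \<delta> i k * f k) = f i" "(\<Sum>k\<in>UNIV. f k * \<delta> k i) = f i" for i and f :: "'n \<Rightarrow> real"
    by (simp_all add: \<delta>_def if_distrib[of "\<lambda>a. a * _"] if_distrib[of "\<lambda>a. _ * a"] cong: if_cong)
  have "(\<Sum>k\<in>UNIV. (x $ i * x $ k + c * (\<delta> i k - x $ i * x $ k)) * (x $ k * x $ j + d * (\<delta> k j - x $ k * x $ j)))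
    = x $ i * x $ j + c * d * (\<delta> i j - x $ i * x $ j)" for i j
  proof -
    have "(\<Sum>k\<in>UNIV. (x $ i * x $ k + c * (\<delta> i k - x $ i * x $ k)) * (x $ k * x $ j + d * (\<delta> k j - x $ k * x $ j)))
      = (\<Sum>k\<in>UNIV. (1 - c) * (1 - d) * x $ i * x $ j * (x $ k * x $ k) + ((1 - c) * d * x $ i * x $ k) * \<delta> k j
         + \<delta> i k * (c * (1 - d) * x $ k * x $ j) + \<delta> i k * (c * d * \<delta> k j))"
      by (rule sum.cong) (auto simp: algebra_simps)
    also have "\<dots> = (1 - c) * (1 - d) * x $ i * x $ j + (1 - c) * d * x $ i * x $ j
        + c * (1 - d) * x $ i * x $ j + c * d * \<delta> i j"
      by (simp add: sum.distrib d sum_distrib_left[symmetric] sum_component_sq[OF assms])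
    finally show ?thesis by (simp add: algebra_simps)
  qed
  then show ?thesis
    by (simp add: stretch_matrix_def matrix_matrix_mult_def vec_eq_iff \<delta>_def)
qed

lemma stretch_matrix_1 [simp]: "stretch_matrix 1 x = mat 1"
  by (simp add: stretch_matrix_def mat_def vec_eq_iff)

lemma matrix_inv_eqI:
  fixes A :: "real ^ 'n::finite ^ 'n"
  assumes "A ** A' = mat 1" "A' ** A = mat 1"
  shows "matrix_inv A = A'"
proof -
  have "A ** matrix_inv A = mat 1 \<and> matrix_inv A ** A = mat 1"
    unfolding matrix_inv_def by (rule someI[of _ A']) (use assms in blast)
  then show ?thesis by (metis assms(2) matrix_mul_assoc matrix_mul_lid matrix_mul_rid)
qed

lemma matrix_inv_stretch:
  fixes x :: "real ^ 'n::finite"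
  assumes "norm x = 1" "c \<noteq> 0"
  shows "matrix_inv (stretch_matrix c x) = stretch_matrix (inverse c) x"
  using assms by (intro matrix_inv_eqI) (simp_all add: stretch_matrix_mult)

text \<open>An orthogonal matrix with \<open>x\<close> as its \<open>k\<close>-th column conjugates
  it to a diagonal matrix with one entry 1 and all others \<open>c\<close>.\<close>

lemma det_stretch:
  fixes x :: "real ^ 'n::finite"
  assumes "norm x = 1"
  shows "det (stretch_matrix c x) = c ^ (CARD('n) - 1)"
proof -
  obtain k :: 'n where True by simp
  obtain A :: "real ^ 'n ^ 'n" where A: "orthogonal_matrix A" "A *v axis k 1 = x"
    using orthogonal_matrix_exists_basis[OF assms] by blast
  have Ak: "A $ i $ k = x $ i" for i
    using A(2) by (metis matrix_vector_mul_component inner_axis mult.right_neutral inner_commute inner_real_def)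
  define D :: "real ^ 'n ^ 'n" where "D = (\<chi> i j. if i = j then (if i = k then 1 else c) else 0)"
  have AA: "A ** transpose A = mat 1" "transpose A ** A = mat 1"
    using A(1) by (auto simp: orthogonal_matrix_def)
  have sumA: "(\<Sum>l\<in>UNIV. A $ i $ l * A $ j $ l) = (if i = j then 1 else 0)" for i j
    using AA(1) by (simp add: matrix_matrix_mult_def transpose_def mat_def vec_eq_iff)
  have "(A ** D ** transpose A) $ i $ j = stretch_matrix c x $ i $ j" for i j
  proof -
    have AD: "(A ** D) $ i $ l = A $ i $ l * (if l = k then 1 else c)" for l
      by (simp add: matrix_matrix_mult_def D_def if_distrib[of "\<lambda>a. _ * a"] sum.delta' cong: if_cong)
    have "(A ** D ** transpose A) $ i $ j = (\<Sum>l\<in>UNIV. A $ i $ l * (if l = k then 1 else c) * A $ j $ l)"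
      by (simp add: matrix_matrix_mult_def[of "A ** D"] AD transpose_def)
    also have "\<dots> = (\<Sum>l\<in>UNIV. c * (A $ i $ l * A $ j $ l) + (if l = k then (1 - c) * (A $ i $ k * A $ j $ k) else 0))"
      by (rule sum.cong) (auto simp: algebra_simps)
    also have "\<dots> = c * (\<Sum>l\<in>UNIV. A $ i $ l * A $ j $ l) + (1 - c) * (A $ i $ k * A $ j $ k)"
      by (simp add: sum.distrib sum_distrib_left)
    also have "\<dots> = stretch_matrix c x $ i $ j"
      unfolding sumA by (simp add: stretch_matrix_def Ak algebra_simps)
    finally show ?thesis .
  qed
  then have S: "stretch_matrix c x = A ** D ** transpose A" by (simp add: vec_eq_iff)
  have "det A * det (transpose A) = 1" using AA(1) by (metis det_I det_mul)
  then have "det (stretch_matrix c x) = det D"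
    unfolding S det_mul by (metis mult.assoc mult.commute mult.right_neutral)
  also have "\<dots> = (\<Prod>i\<in>UNIV. D $ i $ i)" by (rule det_diagonal) (simp add: D_def)
  also have "\<dots> = (\<Prod>i\<in>insert k (UNIV - {k}). if i = k then 1 else c)"
    by (rule prod.cong) (auto simp: D_def)
  also have "\<dots> = (\<Prod>i\<in>UNIV - {k}. c)" by (subst prod.insert) (auto intro!: prod.cong)
  also have "\<dots> = c ^ (CARD('n) - 1)" by (simp add: card_Diff_singleton)
  finally show ?thesis .
qed

lemma has_derivative_param:
  fixes x :: "real ^ 'n::finite"
  assumes "x \<noteq> 0"
  shows "(param has_derivative (\<lambda>v. (sgn x \<bullet> v, (v - (sgn x \<bullet> v) *\<^sub>R sgn x) /\<^sub>R norm x))) (at x)"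
proof -
  have n: "norm x > 0" using assms by simp
  have "((\<lambda>x. (norm x - 1, x /\<^sub>R norm x)) has_derivative
     (\<lambda>v. (sgn x \<bullet> v, (- (inverse (norm x) * (sgn x \<bullet> v) * inverse (norm x))) *\<^sub>R x + inverse (norm x) *\<^sub>R v))) (at x)"
    using assms has_derivative_norm[OF assms]
    by (auto intro!: derivative_eq_intros simp: inner_commute)
  moreover have "(- (inverse (norm x) * (sgn x \<bullet> v) * inverse (norm x))) *\<^sub>R x + inverse (norm x) *\<^sub>R v
      = (v - (sgn x \<bullet> v) *\<^sub>R sgn x) /\<^sub>R norm x" for v
    by (simp add: sgn_div_norm algebra_simps)
  ultimately show ?thesis by (simp add: param_def[abs_def])
qed

text \<open>The last clause of \<open>metric_of_revolution\<close>, isolated so that the warping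
  function can be named.\<close>

definition warp_metric :: "real \<Rightarrow> (real \<Rightarrow> real) \<Rightarrow> 'n::finite metric \<Rightarrow> bool" where
  "warp_metric L h g \<longleftrightarrow> (\<forall>z\<in>cylinder L. \<forall>v\<in>tangent_space z. \<forall>w\<in>tangent_space z.
           g z v w = fst v * fst w + (h (fst z))\<^sup>2 * (snd v \<bullet> snd w))"

lemma param_in_cylinder:
  assumes "1 \<le> norm x" "norm x \<le> 1 + L"
  shows "param x \<in> cylinder L"
proof -
  have "norm x \<noteq> 0" using assms by linarith
  then show ?thesis using assms by (auto simp: param_def cylinder_def)
qed

text \<open>\<open>param\<close> preserves radial lengths, while it takes the sphere of radius
  \<open>norm x\<close> to the unit sphere, which the metric scales by \<open>h\<close>. Tangential
  lengths are thus multiplied by \<open>h (norm x - 1) / norm x\<close>.\<close>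

lemma metric_matrix_warp:
  fixes x :: "real ^ 'n::finite"
  assumes g: "warp_metric L h g" and x: "1 \<le> norm x" "norm x \<le> 1 + L"
  shows "metric_matrix g x = stretch_matrix ((h (norm x - 1) / norm x)\<^sup>2) (sgn x)"
proof -
  have x0: "x \<noteq> 0" using x by auto
  define p where "p = sgn x"
  have p: "p \<bullet> p = 1" using x0 by (simp add: p_def norm_sgn flip: norm_eq_1)
  define D where "D v = (p \<bullet> v, (v - (p \<bullet> v) *\<^sub>R p) /\<^sub>R norm x)" for v
  have D: "frechet_derivative param (at x) = D"
    using frechet_derivative_at[OF has_derivative_param[OF x0]] by (simp add: D_def[abs_def] p_def)
  have sp: "snd (param x) = p" by (simp add: param_def p_def sgn_div_norm)
  have tan: "D v \<in> tangent_space (param x)" for v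
    by (simp add: tangent_space_def sp D_def inner_diff_right p)
  have "g (param x) (D v) (D w) = (p \<bullet> v) * (p \<bullet> w) + (h (norm x - 1) / norm x)\<^sup>2 * (v \<bullet> w - (p \<bullet> v) * (p \<bullet> w))" for v w
  proof -
    have "g (param x) (D v) (D w) = fst (D v) * fst (D w) + (h (fst (param x)))\<^sup>2 * (snd (D v) \<bullet> snd (D w))"
      using g param_in_cylinder[OF x] tan unfolding warp_metric_def by blast
    moreover have "snd (D v) \<bullet> snd (D w) = (v \<bullet> w - (p \<bullet> v) * (p \<bullet> w)) / (norm x)\<^sup>2"
      using x0 by (simp add: D_def inner_diff p inner_commute field_simps power2_eq_square)
    ultimately show ?thesis by (simp add: D_def param_def power_divide)
  qed
  then show ?thesis
    unfolding metric_matrix_def D stretch_matrix_def p_def[symmetric]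
    by (simp add: vec_eq_iff inner_axis inner_axis_axis) (simp add: axis_def)
qed

lemma sqrt_det_metric_matrix_warp:
  fixes x :: "real ^ 'n::finite"
  assumes "warp_metric L h g" "1 \<le> norm x" "norm x \<le> 1 + L" "h (norm x - 1) > 0"
  shows "sqrt (det (metric_matrix g x)) = (h (norm x - 1) / norm x) ^ (CARD('n) - 1)"
proof -
  have "x \<noteq> 0" using assms(2) by auto
  then have "det (metric_matrix g x) = ((h (norm x - 1) / norm x) ^ (CARD('n) - 1))\<^sup>2"
    using metric_matrix_warp[OF assms(1-3)] by (simp add: det_stretch norm_sgn power_mult[symmetric] mult.commute)
  then show ?thesis using assms(4) by simp
qed

lemma matrix_inv_metric_matrix_warp:
  fixes x :: "real ^ 'n::finite"
  assumes "warp_metric L h g" "1 \<le> norm x" "norm x \<le> 1 + L" "h (norm x - 1) > 0"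
  shows "matrix_inv (metric_matrix g x) = stretch_matrix ((norm x / h (norm x - 1))\<^sup>2) (sgn x)"
proof -
  have "x \<noteq> 0" using assms(2) by auto
  then show ?thesis
    using metric_matrix_warp[OF assms(1-3)] assms(4)
    by (simp add: matrix_inv_stretch norm_sgn power_divide field_simps)
qed

subsection \<open>Separated solutions of the Laplace equation\<close>

lemma partial_cong:
  assumes "open U" "x \<in> U" "\<And>y. y \<in> U \<Longrightarrow> f y = g y"
  shows "partial i f x = partial i g x"
proof -
  have "(f has_derivative D) (at x) \<longleftrightarrow> (g has_derivative D) (at x)" for D
    using assms has_derivative_transform_within_open[of f D x UNIV U g]
      has_derivative_transform_within_open[of g D x UNIV U f] by auto
  then show ?thesis by (simp add: partial_def frechet_derivative_def)
qed

lemma partialI: "(u has_derivative D) (at x) \<Longrightarrow> partial i u x = D (axis i 1)"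
  unfolding partial_def by (simp flip: frechet_derivative_at)

definition open_annulus :: "real \<Rightarrow> (real ^ 'n::finite) set" where
  "open_annulus L = {x. 1 < norm x \<and> norm x < 1 + L}"

lemma open_open_annulus: "open (open_annulus L)"
  unfolding open_annulus_def by (intro open_Collect_conj open_Collect_less continuous_intros)

text \<open>This is \<open>sqrt (det G)\<close> times the inverse of \<open>G\<close>, the
  coefficient matrix of the Laplacian in divergence form. Through \<open>h\<close> its smoothness is
  accessible, whereas \<open>g\<close> is only prescribed over the cylinder.\<close>

definition diffusion_coeff :: "(real \<Rightarrow> real) \<Rightarrow> real ^ 'n::finite \<Rightarrow> 'n \<Rightarrow> 'n \<Rightarrow> real" where
  "diffusion_coeff h x i j = (h (norm x - 1) / norm x) ^ (CARD('n) - 1) *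
     stretch_matrix ((norm x / h (norm x - 1))\<^sup>2) (sgn x) $ i $ j"

lemma laplace_beltrami_warp:
  fixes x :: "real ^ 'n::finite"
  assumes g: "warp_metric L h g" and h: "\<And>r. r \<in> {0..L} \<Longrightarrow> h r > 0" and x: "x \<in> open_annulus L"
  shows "laplace_beltrami g f x =
    (\<Sum>i\<in>UNIV. partial i (\<lambda>y. \<Sum>j\<in>UNIV. diffusion_coeff h y i j * partial j (f \<circ> param) y) x)
      / (h (norm x - 1) / norm x) ^ (CARD('n) - 1)"
proof -
  have "partial i (\<lambda>y. sqrt (det (metric_matrix g y)) *
        (\<Sum>j\<in>UNIV. matrix_inv (metric_matrix g y) $ i $ j * partial j (f \<circ> param) y)) x =
      partial i (\<lambda>y. \<Sum>j\<in>UNIV. diffusion_coeff h y i j * partial j (f \<circ> param) y) x" for i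
  proof (rule partial_cong[OF open_open_annulus x])
    fix y :: "real ^ 'n" assume "y \<in> open_annulus L"
    then have y: "1 \<le> norm y" "norm y \<le> 1 + L" "h (norm y - 1) > 0"
      using h by (auto simp: open_annulus_def)
    show "sqrt (det (metric_matrix g y)) *
        (\<Sum>j\<in>UNIV. matrix_inv (metric_matrix g y) $ i $ j * partial j (f \<circ> param) y) =
       (\<Sum>j\<in>UNIV. diffusion_coeff h y i j * partial j (f \<circ> param) y)"
      by (simp add: sqrt_det_metric_matrix_warp[OF g y] matrix_inv_metric_matrix_warp[OF g y]
        diffusion_coeff_def sum_distrib_left mult.assoc)
  qed
  moreover have "1 \<le> norm x" "norm x \<le> 1 + L" "h (norm x - 1) > 0"
    using x h by (auto simp: open_annulus_def)
  ultimately show ?thesis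
    unfolding laplace_beltrami_def by (simp add: sqrt_det_metric_matrix_warp[OF g])
qed

lemma stretch_matrix_apply:
  "(\<Sum>j\<in>UNIV. stretch_matrix c x $ i $ j * z j) = (1 - c) * x $ i * (\<Sum>j\<in>UNIV. x $ j * z j) + c * z i"
proof -
  have "(\<Sum>j\<in>UNIV. stretch_matrix c x $ i $ j * z j) =
      (\<Sum>j\<in>UNIV. (1 - c) * x $ i * (x $ j * z j) + (if i = j then c * z i else 0))"
    by (rule sum.cong) (auto simp: stretch_matrix_def algebra_simps)
  then show ?thesis by (simp add: sum.distrib sum_distrib_left)
qed

lemma has_derivative_radial:
  fixes x :: "real ^ 'n::finite"
  assumes "x \<noteq> 0" "(\<Phi> has_real_derivative D) (at (norm x))"
  shows "((\<lambda>y. \<Phi> (norm y)) has_derivative (\<lambda>v. D * (sgn x \<bullet> v))) (at x)"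
proof -
  have "((\<lambda>y. \<Phi> (norm y)) has_derivative (\<lambda>v. D * (v \<bullet> sgn x))) (at x)"
    using has_derivative_compose[OF has_derivative_norm[OF assms(1)]] assms(2)
    unfolding has_field_derivative_def by blast
  then show ?thesis by (simp add: inner_commute)
qed

lemma has_derivative_component: "((\<lambda>y. y $ k) has_derivative (\<lambda>v. v $ k)) F"
  by (rule bounded_linear_imp_has_derivative) (rule bounded_linear_vec_nth)

lemma DERIV_divide_power:
  fixes f :: "real \<Rightarrow> real"
  assumes "(f has_real_derivative D) (at \<rho>)" "\<rho> \<noteq> 0"
  shows "((\<lambda>\<rho>. f \<rho> / \<rho> ^ m) has_real_derivative D / \<rho> ^ m - real m * f \<rho> / \<rho> ^ Suc m) (at \<rho>)"
proof (cases m)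
  case 0 then show ?thesis using assms by simp
next
  case (Suc k)
  have "((\<lambda>\<rho>. f \<rho> / \<rho> ^ m) has_real_derivative
      (D * \<rho> ^ m - f \<rho> * (real m * \<rho> ^ (m - Suc 0))) / (\<rho> ^ m * \<rho> ^ m)) (at \<rho>)"
    using assms by (intro DERIV_divide DERIV_pow) auto
  moreover have "(D * \<rho> ^ m - f \<rho> * (real m * \<rho> ^ (m - Suc 0))) / (\<rho> ^ m * \<rho> ^ m)
      = D / \<rho> ^ m - real m * f \<rho> / \<rho> ^ Suc m"
    using assms(2) Suc by (simp add: field_simps)
  ultimately show ?thesis by simp
qed

lemma DERIV_shift1: "(f has_real_derivative D) (at (\<rho> - 1)) \<Longrightarrow> ((\<lambda>\<rho>. f (\<rho> - 1)) has_real_derivative D) (at \<rho>)"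
  using DERIV_shift[of f D \<rho> "- 1"] by simp

lemma axis_1_nth: "axis i (1::real) $ k = (if i = k then 1 else 0)"
  by (simp add: axis_def)

lemma sgn_vec_nth: "sgn x $ i = x $ i / norm x" for x :: "real ^ 'n::finite"
  by (simp add: sgn_div_norm divide_inverse mult.commute)

lemma sum_sq_norm: "(\<Sum>i\<in>UNIV. x $ i * x $ i) = (norm x)\<^sup>2" for x :: "real ^ 'n::finite"
  by (simp add: power2_norm_eq_inner inner_vec_def)

lemma sum_sgn: "(\<Sum>i\<in>UNIV. sgn x $ i * x $ i) = norm x" for x :: "real ^ 'n::finite"
  by (cases "x = 0") (simp_all add: sgn_vec_nth sum_divide_distrib[symmetric] sum_sq_norm power2_eq_square)

lemma divergence_radial:
  fixes x :: "real ^ 'n::finite"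
  assumes "x \<noteq> 0" "(\<Phi> has_real_derivative D) (at (norm x))"
  shows "(\<Sum>i\<in>UNIV. partial i (\<lambda>y. \<Phi> (norm y) * y $ i) x) = D * norm x + real CARD('n) * \<Phi> (norm x)"
proof -
  have "partial i (\<lambda>y. \<Phi> (norm y) * y $ i) x = D * (sgn x $ i * x $ i) + \<Phi> (norm x)" for i
    by (subst partialI[OF has_derivative_mult[OF has_derivative_radial[OF assms] has_derivative_component]])
      (simp add: inner_axis)
  then show ?thesis by (simp add: sum.distrib sum_distrib_left[symmetric] sum_sgn)
qed

text \<open>A field along the radial direction plus one along the \<open>k\<close>-th axis: this is
  the shape of the flux of a mode.\<close>

lemma divergence_mode:
  fixes x :: "real ^ 'n::finite"
  assumes "x \<noteq> 0" "(\<Phi> has_real_derivative D) (at (norm x))" "(\<Theta> has_real_derivative E) (at (norm x))"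
  shows "(\<Sum>i\<in>UNIV. partial i (\<lambda>y. \<Phi> (norm y) * y $ k * y $ i + (if i = k then \<Theta> (norm y) else 0)) x)
    = (D * norm x + (real CARD('n) + 1) * \<Phi> (norm x) + E / norm x) * x $ k"
proof -
  have "partial i (\<lambda>y. \<Phi> (norm y) * y $ k * y $ i + (if i = k then \<Theta> (norm y) else 0)) x
      = D * x $ k * (sgn x $ i * x $ i) + \<Phi> (norm x) * x $ k + (if i = k then \<Phi> (norm x) * x $ k + E * sgn x $ k else 0)" for i
  proof (cases "i = k")
    case True
    have "((\<lambda>y. \<Phi> (norm y) * y $ k * y $ k + \<Theta> (norm y)) has_derivative
       (\<lambda>v. (\<Phi> (norm x) * x $ k * v $ k + (\<Phi> (norm x) * v $ k + D * (sgn x \<bullet> v) * x $ k) * x $ k) + E * (sgn x \<bullet> v))) (at x)"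
      by (intro has_derivative_add has_derivative_mult has_derivative_radial has_derivative_component assms)
    from partialI[OF this, of k] True show ?thesis by (simp add: inner_axis algebra_simps)
  next
    case False
    have "((\<lambda>y. \<Phi> (norm y) * y $ k * y $ i) has_derivative
       (\<lambda>v. \<Phi> (norm x) * x $ k * v $ i + (\<Phi> (norm x) * v $ k + D * (sgn x \<bullet> v) * x $ k) * x $ i)) (at x)"
      by (intro has_derivative_add has_derivative_mult has_derivative_radial has_derivative_component assms)
    from partialI[OF this, of i] False show ?thesis by (simp add: inner_axis axis_1_nth algebra_simps)
  qed
  then have "(\<Sum>i\<in>UNIV. partial i (\<lambda>y. \<Phi> (norm y) * y $ k * y $ i + (if i = k then \<Theta> (norm y) else 0)) x)
      = D * x $ k * norm x + real CARD('n) * (\<Phi> (norm x) * x $ k) + (\<Phi> (norm x) * x $ k + E * sgn x $ k)"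
    by (simp add: sum.distrib sum_distrib_left[symmetric] sum_sgn)
  then show ?thesis by (simp add: sgn_vec_nth algebra_simps)
qed

text \<open>The flux \<open>p = h^(n-1) a'\<close> is a separate unknown, so \<open>a\<close> itself
  is never differentiated twice. Constant \<open>p\<close> gives harmonic functions, and
  \<open>p t = t\<close> the strictly subharmonic one of the maximum principle.\<close>

lemma laplace_beltrami_radial:
  fixes x :: "real ^ 'n::finite"
  assumes g: "warp_metric L h g" and h: "\<And>r. r \<in> {0..L} \<Longrightarrow> h r > 0" and x: "x \<in> open_annulus L"
    and a: "\<And>r. r \<in> {0<..<L} \<Longrightarrow> (a has_real_derivative p r / h r ^ (CARD('n) - 1)) (at r)"
    and p: "\<And>r. r \<in> {0<..<L} \<Longrightarrow> (p has_real_derivative p' r) (at r)"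
  shows "laplace_beltrami g (\<lambda>z. a (fst z)) x = p' (norm x - 1) / h (norm x - 1) ^ (CARD('n) - 1)"
proof -
  obtain m where N: "CARD('n) = Suc m" using zero_less_card_finite[where 'a='n] gr0_conv_Suc by blast
  define \<Phi> where "\<Phi> \<rho> = p (\<rho> - 1) / \<rho> ^ CARD('n)" for \<rho>
  have x0: "x \<noteq> 0" "norm x \<noteq> 0" "norm x - 1 \<in> {0<..<L}" using x by (auto simp: open_annulus_def)
  have flux: "(\<Sum>j\<in>UNIV. diffusion_coeff h y i j * partial j ((\<lambda>z. a (fst z)) \<circ> param) y) = \<Phi> (norm y) * y $ i"
    if "y \<in> open_annulus L" for y :: "real ^ 'n" and i
  proof -
    define \<rho> where "\<rho> = norm y"
    define H where "H = h (\<rho> - 1)"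
    define c where "c = (\<rho> / H)\<^sup>2"
    have y: "y \<noteq> 0" "\<rho> - 1 \<in> {0<..<L}" "\<rho> > 0" using that by (auto simp: open_annulus_def \<rho>_def)
    then have H: "H > 0" using h by (auto simp: H_def)
    have d: "partial j ((\<lambda>z. a (fst z)) \<circ> param) y = p (\<rho> - 1) / H ^ (CARD('n) - 1) * sgn y $ j" for j
    proof -
      have "((\<lambda>\<rho>. a (\<rho> - 1)) has_real_derivative p (\<rho> - 1) / H ^ (CARD('n) - 1)) (at (norm y))"
        using DERIV_shift1[OF a[OF y(2)]] by (simp add: \<rho>_def H_def)
      from partialI[OF has_derivative_radial[OF y(1) this], of j]
      show ?thesis by (simp add: param_def o_def inner_axis)
    qed
    have s: "(\<Sum>j\<in>UNIV. sgn y $ j * (q * sgn y $ j)) = q" for q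
      using y(1) sum_component_sq[of "sgn y"] by (simp add: mult.left_commute[of _ q] sum_distrib_left[symmetric] norm_sgn)
    have "(\<Sum>j\<in>UNIV. diffusion_coeff h y i j * partial j ((\<lambda>z. a (fst z)) \<circ> param) y) =
        (H / \<rho>) ^ (CARD('n) - 1) * (\<Sum>j\<in>UNIV. stretch_matrix c (sgn y) $ i $ j * (p (\<rho> - 1) / H ^ (CARD('n) - 1) * sgn y $ j))"
      unfolding diffusion_coeff_def d by (simp add: sum_distrib_left mult.assoc c_def H_def \<rho>_def)
    also have "\<dots> = (H / \<rho>) ^ (CARD('n) - 1) * (p (\<rho> - 1) / H ^ (CARD('n) - 1)) * sgn y $ i"
      unfolding stretch_matrix_apply s by (simp only: left_diff_distrib) (simp add: mult.assoc)
    also have "\<dots> = \<Phi> (norm y) * y $ i"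
      unfolding \<Phi>_def \<rho>_def[symmetric] sgn_vec_nth using y H by (simp add: N power_divide)
    finally show ?thesis .
  qed
  define \<rho> where "\<rho> = norm x"
  have \<Phi>': "(\<Phi> has_real_derivative p' (\<rho> - 1) / \<rho> ^ CARD('n) - real CARD('n) * p (\<rho> - 1) / \<rho> ^ Suc CARD('n)) (at (norm x))"
    using DERIV_divide_power[OF DERIV_shift1[OF p[OF x0(3)]] x0(2)] by (simp add: \<Phi>_def[abs_def] \<rho>_def)
  have "(\<Sum>i\<in>UNIV. partial i (\<lambda>y. \<Sum>j\<in>UNIV. diffusion_coeff h y i j * partial j ((\<lambda>z. a (fst z)) \<circ> param) y) x)
      = (\<Sum>i\<in>UNIV. partial i (\<lambda>y. \<Phi> (norm y) * y $ i) x)"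
    by (intro sum.cong partial_cong[OF open_open_annulus x] flux refl)
  also have "\<dots> = p' (\<rho> - 1) / \<rho> ^ (CARD('n) - 1)"
    unfolding divergence_radial[OF x0(1) \<Phi>'] using x0(2) unfolding \<Phi>_def \<rho>_def[symmetric]
    by (simp add: N field_simps)
  finally show ?thesis
    using h x0(2) by (subst laplace_beltrami_warp[OF g _ x]) (auto simp: \<rho>_def power_divide N)
qed

text \<open>The coordinates are eigenfunctions of the Laplacian of the unit sphere with eigenvalue
  \<open>n - 1\<close>, which turns harmonicity into the first-order system for \<open>a\<close> and
  its flux \<open>p\<close>. The derivative of \<open>h\<close> enters through the tangential flux
  and cancels.\<close>

lemma laplace_beltrami_mode:
  fixes x :: "real ^ 'n::finite"
  assumes g: "warp_metric L h g" and h: "\<And>r. r \<in> {0..L} \<Longrightarrow> h r > 0" and x: "x \<in> open_annulus L"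
    and a: "\<And>r. r \<in> {0<..<L} \<Longrightarrow> (a has_real_derivative p r / h r ^ (CARD('n) - 1)) (at r)"
    and p: "\<And>r. r \<in> {0<..<L} \<Longrightarrow> (p has_real_derivative (real CARD('n) - 1) * h r ^ (CARD('n) - 3) * a r) (at r)"
    and h': "\<And>r. r \<in> {0<..<L} \<Longrightarrow> (h has_real_derivative h' r) (at r)"
    and N: "CARD('n) \<ge> 3"
  shows "laplace_beltrami g (\<lambda>z. a (fst z) * snd z $ k) x = 0"
proof -
  obtain m where m: "CARD('n) = m + 3" using N by (metis le_add_diff_inverse2)
  define q where "q r = h r ^ m * a r" for r
  \<comment> \<open>The tangential projection of the \<open>k\<close>-th axis is the axis minus its
    radial part. \<Theta> belongs to the axis, and \<Phi> to the radial flux \<open>p\<close>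
    corrected by that radial part.\<close>
  define \<Phi> where "\<Phi> \<rho> = p (\<rho> - 1) / \<rho> ^ (m + 4) - q (\<rho> - 1) / \<rho> ^ (m + 3)" for \<rho>
  define \<Theta> where "\<Theta> \<rho> = q (\<rho> - 1) / \<rho> ^ (m + 1)" for \<rho>
  have x0: "x \<noteq> 0" "norm x \<noteq> 0" "norm x - 1 \<in> {0<..<L}" using x by (auto simp: open_annulus_def)
  have flux: "(\<Sum>j\<in>UNIV. diffusion_coeff h y i j * partial j ((\<lambda>z. a (fst z) * snd z $ k) \<circ> param) y)
       = \<Phi> (norm y) * y $ k * y $ i + (if i = k then \<Theta> (norm y) else 0)"
    if "y \<in> open_annulus L" for y :: "real ^ 'n" and i
  proof -
    define \<rho> where "\<rho> = norm y"
    define H where "H = h (\<rho> - 1)"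
    define c where "c = (\<rho> / H)\<^sup>2"
    define e where "e = sgn y"
    define P where "P = p (\<rho> - 1) / H ^ (m + 2)"
    define A where "A = a (\<rho> - 1) / \<rho>"
    have y: "y \<noteq> 0" "\<rho> - 1 \<in> {0<..<L}" "\<rho> > 0" using that by (auto simp: open_annulus_def \<rho>_def)
    then have H: "H > 0" using h by (auto simp: H_def)
    have e: "e $ j = y $ j / \<rho>" for j by (simp add: e_def \<rho>_def sgn_vec_nth)
    have ee: "(\<Sum>j\<in>UNIV. e $ j * e $ j) = 1"
      using y(1) sum_component_sq[of e] by (simp add: e_def norm_sgn)
    have d: "partial j ((\<lambda>z. a (fst z) * snd z $ k) \<circ> param) y = (P - A) * e $ k * e $ j + (if j = k then A else 0)" for j
    proof -
      have "((\<lambda>\<rho>. a (\<rho> - 1) / \<rho> ^ 1) has_real_derivative P / \<rho> - A / \<rho>) (at (norm y))"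
        using DERIV_divide_power[OF DERIV_shift1[OF a[OF y(2)]], of 1] y
        by (simp add: \<rho>_def[symmetric] H_def P_def A_def m)
      then have "((\<lambda>y. a (norm y - 1) / norm y ^ 1 * y $ k) has_derivative
          (\<lambda>v. a (norm y - 1) / norm y ^ 1 * v $ k + ((P / \<rho> - A / \<rho>) * (sgn y \<bullet> v)) * y $ k)) (at y)"
        by (intro has_derivative_mult has_derivative_component has_derivative_radial[OF y(1)])
      from partialI[OF this, of j] y(3)
      show ?thesis by (auto simp: param_def o_def inner_axis e_def[symmetric] e A_def \<rho>_def[symmetric] axis_1_nth field_simps)
    qed
    have "(\<Sum>j\<in>UNIV. e $ j * ((P - A) * e $ k * e $ j + (if j = k then A else 0))) =
       (\<Sum>j\<in>UNIV. (P - A) * e $ k * (e $ j * e $ j) + (if j = k then A * e $ k else 0))"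
      by (rule sum.cong) (auto simp: algebra_simps)
    also have "\<dots> = (P - A) * e $ k * (\<Sum>j\<in>UNIV. e $ j * e $ j) + A * e $ k"
      unfolding sum.distrib sum_distrib_left[symmetric] by simp
    also have "\<dots> = P * e $ k" by (simp add: ee algebra_simps)
    finally have s: "(\<Sum>j\<in>UNIV. e $ j * ((P - A) * e $ k * e $ j + (if j = k then A else 0))) = P * e $ k" .
    have "(\<Sum>j\<in>UNIV. diffusion_coeff h y i j * partial j ((\<lambda>z. a (fst z) * snd z $ k) \<circ> param) y) =
        (H / \<rho>) ^ (m + 2) * (\<Sum>j\<in>UNIV. stretch_matrix c e $ i $ j * ((P - A) * e $ k * e $ j + (if j = k then A else 0)))"
      unfolding diffusion_coeff_def d by (simp add: sum_distrib_left mult.assoc c_def H_def \<rho>_def m e_def)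
    also have "\<dots> = (H / \<rho>) ^ (m + 2) * ((P - c * A) * e $ k * e $ i + (if i = k then c * A else 0))"
      unfolding stretch_matrix_apply s by (auto simp: algebra_simps)
    also have "\<dots> = \<Phi> (norm y) * y $ k * y $ i + (if i = k then \<Theta> (norm y) else 0)"
    proof -
      have "(H / \<rho>) ^ (m + 2) * P = p (\<rho> - 1) / \<rho> ^ (m + 2)" using H y by (simp add: P_def power_divide)
      moreover have "(H / \<rho>) ^ (m + 2) * (c * A) = \<Theta> \<rho>"
        using H y by (simp add: c_def A_def \<Theta>_def q_def H_def power_divide power_add power2_eq_square field_simps)
      moreover have "\<Phi> \<rho> = (p (\<rho> - 1) / \<rho> ^ (m + 2) - \<Theta> \<rho>) / \<rho>\<^sup>2"
        using y by (simp add: \<Phi>_def \<Theta>_def power_add power2_eq_square field_simps numeral_eq_Suc)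
      ultimately have "(H / \<rho>) ^ (m + 2) * (P - c * A) = \<Phi> \<rho> * \<rho>\<^sup>2" "(H / \<rho>) ^ (m + 2) * (c * A) = \<Theta> \<rho>"
        using y by (simp_all add: right_diff_distrib)
      then have "(H / \<rho>) ^ (m + 2) * ((P - c * A) * e $ k * e $ i + (if i = k then c * A else 0))
         = \<Phi> \<rho> * \<rho>\<^sup>2 * e $ k * e $ i + (if i = k then \<Theta> \<rho> else 0)"
        by (simp add: distrib_left mult.assoc[symmetric])
      then show ?thesis using y by (simp add: e \<rho>_def[symmetric] power2_eq_square)
    qed
    finally show ?thesis .
  qed
  define \<rho> where "\<rho> = norm x"
  define q' where "q' = real m * h (\<rho> - 1) ^ (m - 1) * h' (\<rho> - 1) * a (\<rho> - 1) + h (\<rho> - 1) ^ m * (p (\<rho> - 1) / h (\<rho> - 1) ^ (m + 2))"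
  have q': "(q has_real_derivative q') (at (norm x - 1))"
    unfolding q_def[abs_def] q'_def \<rho>_def
    using a[OF x0(3)] h'[OF x0(3)] by (auto intro!: derivative_eq_intros simp: m)
  have p': "(p has_real_derivative (real m + 2) * q (\<rho> - 1)) (at (norm x - 1))"
    using p[OF x0(3)] by (simp add: m q_def \<rho>_def mult.assoc add.commute)
  note D = DERIV_divide_power[OF DERIV_shift1[OF p'] x0(2), of "m + 4"]
    DERIV_divide_power[OF DERIV_shift1[OF q'] x0(2)]
  have \<Phi>': "(\<Phi> has_real_derivative ((real m + 2) * q (\<rho> - 1) / \<rho> ^ (m + 4) - (real m + 4) * p (\<rho> - 1) / \<rho> ^ (m + 5))
      - (q' / \<rho> ^ (m + 3) - (real m + 3) * q (\<rho> - 1) / \<rho> ^ (m + 4))) (at (norm x))"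
    unfolding \<Phi>_def[abs_def] using DERIV_diff[OF D(1) D(2)[of "m + 3"]] by (simp add: \<rho>_def add.commute)
  have \<Theta>': "(\<Theta> has_real_derivative q' / \<rho> ^ (m + 1) - (real m + 1) * q (\<rho> - 1) / \<rho> ^ (m + 2)) (at (norm x))"
    unfolding \<Theta>_def[abs_def] using D(2)[of "m + 1"] by (simp add: \<rho>_def add.commute)
  have "(\<Sum>i\<in>UNIV. partial i (\<lambda>y. \<Sum>j\<in>UNIV. diffusion_coeff h y i j * partial j ((\<lambda>z. a (fst z) * snd z $ k) \<circ> param) y) x)
      = (\<Sum>i\<in>UNIV. partial i (\<lambda>y. \<Phi> (norm y) * y $ k * y $ i + (if i = k then \<Theta> (norm y) else 0)) x)"
    by (intro sum.cong partial_cong[OF open_open_annulus x] flux refl)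
  also have "\<dots> = 0"
  proof -
    \<comment> \<open>The terms in \<open>q'\<close>, \<open>R\<close> and \<open>Q\<close> cancel
      separately. For \<open>Q\<close> the coefficients are
      \<open>(m+2) + (m+3) - (m+4) - (m+1) = 0\<close>, the first being the eigenvalue of the
      sphere.\<close>
    have "(((real m + 2) * Q / \<rho> ^ (m + 4) - (real m + 4) * R / \<rho> ^ (m + 5))
      - (q' / \<rho> ^ (m + 3) - (real m + 3) * Q / \<rho> ^ (m + 4))) * \<rho> + (real (m + 3) + 1) * (R / \<rho> ^ (m + 4) - Q / \<rho> ^ (m + 3))
      + (q' / \<rho> ^ (m + 1) - (real m + 1) * Q / \<rho> ^ (m + 2)) / \<rho> = 0" for Q R
      using x0(2) by (simp add: \<rho>_def[symmetric] power_add field_simps numeral_eq_Suc)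
    then show ?thesis
      unfolding divergence_mode[OF x0(1) \<Phi>' \<Theta>'] by (simp add: \<Phi>_def \<rho>_def m)
  qed
  finally show ?thesis
    using h by (subst laplace_beltrami_warp[OF g _ x]) auto
qed

subsection \<open>Profiles and separated Steklov eigenfunctions\<close>

text \<open>The interval \<open>(l, r)\<close> is strictly larger than \<open>[0, L]\<close>, so
  eigenfunctions extend smoothly past the boundary and all derivatives are two-sided. Continuity and
  positivity up to \<open>l\<close> and \<open>r\<close> keep the coefficients of the differential
  systems bounded.\<close>

definition profile :: "real \<Rightarrow> real \<Rightarrow> real \<Rightarrow> (real \<Rightarrow> real) \<Rightarrow> bool" where
  "profile l L r h \<longleftrightarrow> l < 0 \<and> 0 < L \<and> L < r \<and> (\<forall>t\<in>{l..r}. 0 < h t) \<and> continuous_on {l..r} h \<and>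
     (\<forall>k. C_k_on k {l<..<r} h) \<and> h 0 = 1 \<and> h L = 1 \<and> (\<forall>t\<in>{0..L}. \<bar>deriv h t\<bar> \<le> 1)"

lemma metric_of_revolution_profile:
  assumes "metric_of_revolution L g" "L > 0"
  shows "\<exists>h l r. profile l L r h \<and> warp_metric L h g"
proof -
  obtain h where h: "smooth_near {0..L} h" "\<forall>r\<in>{0..L}. h r > 0"
    "\<forall>r\<in>{0..L}. \<bar>deriv h r\<bar> \<le> 1" "h 0 = 1" "h L = 1" "warp_metric L h g"
    using assms(1) unfolding metric_of_revolution_def warp_metric_def by blast
  obtain U where U: "open U" "{0..L} \<subseteq> U" "\<And>k. C_k_on k U h"
    using h(1) unfolding smooth_near_def by blast
  have cont: "continuous_on U h" using U(3)[of 0] by simp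
  define V where "V = U \<inter> h -` {0<..}"
  have V: "open V" unfolding V_def
    using cont U(1) by (intro continuous_open_preimage) auto
  have sub: "{0..L} \<subseteq> V" using U(2) h(2) by (auto simp: V_def)
  then have "0 \<in> V" "L \<in> V" using assms(2) by auto
  then obtain d e where d: "d > 0" "cball 0 d \<subseteq> V" and e: "e > 0" "cball L e \<subseteq> V"
    using V unfolding open_contains_cball by metis
  have V': "{- d..L + e} \<subseteq> V"
  proof
    fix t assume t: "t \<in> {- d..L + e}"
    consider "t < 0" | "t \<in> {0..L}" | "t > L" by force
    then show "t \<in> V"
    proof cases
      case 1 then have "t \<in> cball 0 d" using t by (auto simp: dist_real_def)
      then show ?thesis using d by blast
    next
      case 2 then show ?thesis using sub by blast
    next
      case 3 then have "t \<in> cball L e" using t by (auto simp: dist_real_def)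
      then show ?thesis using e by blast
    qed
  qed
  have "profile (- d) L (L + e) h"
    unfolding profile_def
  proof (intro conjI allI)
    show "continuous_on {- d..L + e} h" using V' cont continuous_on_subset unfolding V_def by blast
    show "C_k_on k {- d<..<L + e} h" for k
      by (rule C_k_on_subset[OF U(3)]) (use V' in \<open>auto simp: V_def\<close>)
  qed (use V' d e h assms in \<open>auto simp: V_def\<close>)
  then show ?thesis using h(6) by blast
qed

lemma profile_deriv:
  assumes "profile l L r h" "t \<in> {l<..<r}"
  shows "(h has_real_derivative deriv h t) (at t)"
proof -
  have "C_k_on (Suc 0) {l<..<r} h" using assms(1) unfolding profile_def by blast
  from C_k_on_deriv(2)[OF open_greaterThanLessThan this assms(2)] show ?thesis .
qed

lemma profile_C_k: "profile l L r h \<Longrightarrow> C_k_on k {l<..<r} (\<lambda>t. c * h t ^ m)"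
  unfolding profile_def by (intro C_k_on_mult C_k_on_const C_k_on_power) blast

lemma profile_C_k_inverse:
  assumes "profile l L r h"
  shows "C_k_on k {l<..<r} (\<lambda>t. c * inverse (h t ^ m))"
proof (intro C_k_on_mult C_k_on_const C_k_on_inverse C_k_on_power)
  show "C_k_on k {l<..<r} h" using assms unfolding profile_def by blast
  show "h t ^ m \<noteq> 0" if "t \<in> {l<..<r}" for t
  proof -
    have "h t > 0" using assms that unfolding profile_def by auto
    then show ?thesis by simp
  qed
qed

lemma profile_pos: "profile l L r h \<Longrightarrow> t \<in> {0..L} \<Longrightarrow> h t > 0"
  by (auto simp: profile_def)

lemma profile_le:
  assumes p: "profile l L r h" and t: "t \<in> {0..L}"
  shows "h t \<le> 1 + t" "h t \<le> 1 + (L - t)"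
proof -
  have D: "(h has_real_derivative deriv h s) (at s)" "\<bar>deriv h s\<bar> \<le> 1" if "s \<in> {0..L}" for s
    using that p profile_deriv[OF p, of s] by (auto simp: profile_def)
  have "0 - h 0 \<le> t - h t"
  proof (rule DERIV_nonneg_imp_nondecreasing[of 0 t "\<lambda>s. s - h s"])
    show "\<exists>y. ((\<lambda>s. s - h s) has_real_derivative y) (at s) \<and> 0 \<le> y" if "0 \<le> s" "s \<le> t" for s
      using D[of s] that t by (intro exI[of _ "1 - deriv h s"]) (auto intro!: derivative_eq_intros)
  qed (use t in auto)
  then show "h t \<le> 1 + t" using p by (simp add: profile_def)
  have "t + h t \<le> L + h L"
  proof (rule DERIV_nonneg_imp_nondecreasing[of t L "\<lambda>s. s + h s"])
    show "\<exists>y. ((\<lambda>s. s + h s) has_real_derivative y) (at s) \<and> 0 \<le> y" if "t \<le> s" "s \<le> L" for s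
      using D[of s] that t by (intro exI[of _ "1 + deriv h s"]) (auto intro!: derivative_eq_intros)
  qed (use t in auto)
  then show "h t \<le> 1 + (L - t)" using p by (simp add: profile_def)
qed

lemma smooth_near_fst:
  assumes "l < 0" "L < r" "\<And>k. C_k_on k {l<..<r} a"
  shows "smooth_near (cylinder L :: 'n::finite point set) (\<lambda>z. a (fst z))"
  unfolding smooth_near_def
proof (intro exI conjI allI)
  show "open ({l<..<r} \<times> (UNIV :: (real ^ 'n) set))" by (intro open_Times) auto
  show "cylinder L \<subseteq> {l<..<r} \<times> (UNIV :: (real ^ 'n) set)" using assms by (auto simp: cylinder_def)
  show "C_k_on k ({l<..<r} \<times> (UNIV :: (real ^ 'n) set)) (\<lambda>z. a (fst z))" for k
    by (rule C_k_on_compose[OF _ assms(3)])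
      (auto intro!: C_k_on_bounded_linear bounded_linear_fst)
qed

lemma smooth_near_mult:
  assumes "smooth_near S f" "smooth_near S g"
  shows "smooth_near S (\<lambda>x. f x * g x)"
proof -
  obtain U V where UV: "open U" "S \<subseteq> U" "\<And>k. C_k_on k U f" "open V" "S \<subseteq> V" "\<And>k. C_k_on k V g"
    using assms unfolding smooth_near_def by blast
  have "C_k_on k (U \<inter> V) (\<lambda>x. f x * g x)" for k
    using C_k_on_subset[OF UV(3) Int_lower1] C_k_on_subset[OF UV(6) Int_lower2] by (rule C_k_on_mult)
  then show ?thesis unfolding smooth_near_def
    using UV by (intro exI[of _ "U \<inter> V"]) auto
qed

lemma smooth_near_snd: "smooth_near (cylinder L :: 'n::finite point set) (\<lambda>z. snd z $ k)"
  unfolding smooth_near_def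
  by (intro exI[of _ UNIV]) (auto intro!: C_k_on_bounded_linear
    bounded_linear_compose[OF bounded_linear_vec_nth bounded_linear_snd])

lemma outward_unit_normal_iff:
  assumes g: "warp_metric L h g" and L: "L > 0" and z: "z \<in> {0, L} \<times> sphere 0 1"
    and h: "h 0 > 0" "h L > 0"
  shows "outward_unit_normal L g z \<nu> \<longleftrightarrow> \<nu> = (if fst z = L then 1 else - 1, 0)"
proof -
  have zc: "z \<in> cylinder L" using z L by (auto simp: cylinder_def)
  have gz: "g z v w = fst v * fst w + (h (fst z))\<^sup>2 * (snd v \<bullet> snd w)"
    if "v \<in> tangent_space z" "w \<in> tangent_space z" for v w
    using g zc that unfolding warp_metric_def by blast
  have hz: "h (fst z) > 0" using z h by auto
  show ?thesis
  proof
    assume \<nu>: "outward_unit_normal L g z \<nu>"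
    then have t: "\<nu> \<in> tangent_space z" by (simp add: outward_unit_normal_def)
    then have t0: "(0, snd \<nu>) \<in> tangent_space z" by (simp add: tangent_space_def)
    then have "g z \<nu> (0, snd \<nu>) = 0" using \<nu> by (simp add: outward_unit_normal_def)
    then have s: "snd \<nu> = 0" using gz[OF t t0] hz by simp
    then have "(fst \<nu>)\<^sup>2 = 1" using gz[OF t t] \<nu> by (simp add: outward_unit_normal_def power2_eq_square)
    then have "fst \<nu> = 1 \<or> fst \<nu> = - 1" by (simp add: power2_eq_1_iff)
    moreover have "fst z = L \<and> fst \<nu> > 0 \<or> fst z = 0 \<and> fst \<nu> < 0"
      using \<nu> unfolding outward_unit_normal_def by blast
    ultimately have "fst \<nu> = (if fst z = L then 1 else - 1)" using L by auto
    then show "\<nu> = (if fst z = L then 1 else - 1, 0)" using s by (simp add: prod_eq_iff)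
  next
    assume \<nu>: "\<nu> = (if fst z = L then 1 else - 1, 0)"
    have t: "\<nu> \<in> tangent_space z" by (simp add: tangent_space_def \<nu>)
    show "outward_unit_normal L g z \<nu>"
      unfolding outward_unit_normal_def using t gz[OF t] z L by (auto simp: \<nu>)
  qed
qed

text \<open>As \<open>h\<close> is 1 at both ends, \<open>c\<close> is the radial derivative of
  \<open>a\<close> there. The outward normal at \<open>r = 0\<close> points against the radial
  direction, whence the sign in \<open>bc\<close>.\<close>

lemma steklov_eigenfunction_radial:
  fixes g :: "'n::finite metric"
  assumes p: "profile l L r h" and g: "warp_metric L h g"
    and a: "\<And>t. t \<in> {l<..<r} \<Longrightarrow> (a has_real_derivative c / h t ^ (CARD('n) - 1)) (at t)"
    and bc: "- c = \<sigma> * a 0" "c = \<sigma> * a L" and nz: "a L \<noteq> 0"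
  shows "steklov_eigenfunction L g \<sigma> (\<lambda>z. a (fst z))"
  unfolding steklov_eigenfunction_def
proof (intro conjI ballI allI impI)
  have P: "l < 0" "0 < L" "L < r" "h 0 = 1" "h L = 1" using p by (auto simp: profile_def)
  have smooth: "C_k_on k {l<..<r} a" for k
  proof (rule C_k_on_SucD, rule C_k_on_SucI_real)
    show "(a has_real_derivative c * inverse (h t ^ (CARD('n) - 1))) (at t)" if "t \<in> {l<..<r}" for t
      using a[OF that] by (simp add: divide_inverse)
    show "C_k_on k {l<..<r} (\<lambda>t. c * inverse (h t ^ (CARD('n) - 1)))"
      by (rule profile_C_k_inverse[OF p])
  qed
  show "harmonic L g (\<lambda>z. a (fst z))"
    unfolding harmonic_def
  proof (intro conjI allI impI)
    show "smooth_near (cylinder L) (\<lambda>z::'n point. a (fst z))" using smooth P smooth_near_fst by blast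
    fix x :: "real ^ 'n" assume "1 < norm x \<and> norm x < 1 + L"
    then have x: "x \<in> open_annulus L" by (simp add: open_annulus_def)
    have "laplace_beltrami g (\<lambda>z. a (fst z)) x = 0 / h (norm x - 1) ^ (CARD('n) - 1)"
      by (rule laplace_beltrami_radial[OF g _ x, where p = "\<lambda>_. c" and p' = "\<lambda>_. 0"])
        (use a P profile_pos[OF p] in auto)
    then show "laplace_beltrami g (\<lambda>z. a (fst z)) x = 0" by simp
  qed
  obtain k :: 'n where True by simp
  show "\<exists>z\<in>cylinder L. (\<lambda>z::'n point. a (fst z)) z \<noteq> 0"
    using nz P by (intro bexI[of _ "(L, axis k 1)"]) (auto simp: cylinder_def norm_axis_1)
  fix z \<nu> assume z: "z \<in> {0, L} \<times> sphere 0 1" and "outward_unit_normal L g z \<nu>"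
  then have \<nu>: "\<nu> = (if fst z = L then 1 else - 1, 0)"
    using outward_unit_normal_iff[OF g P(2) z] P by simp
  have zz: "fst z = 0 \<or> fst z = L" using z by auto
  then have "(a has_derivative (*) (c / h (fst z) ^ (CARD('n) - 1))) (at (fst z))"
    using a[of "fst z"] P by (auto simp: has_field_derivative_def)
  from has_derivative_compose[OF bounded_linear_imp_has_derivative[OF bounded_linear_fst] this]
  have "((\<lambda>z. a (fst z)) has_derivative (\<lambda>v. c / h (fst z) ^ (CARD('n) - 1) * fst v)) (at z)" .
  then have "frechet_derivative (\<lambda>z. a (fst z)) (at z) = (\<lambda>v. c / h (fst z) ^ (CARD('n) - 1) * fst v)"
    by (simp flip: frechet_derivative_at)
  then show "frechet_derivative (\<lambda>z. a (fst z)) (at z) \<nu> = \<sigma> * a (fst z)"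
    using zz P bc by (auto simp: \<nu>)
qed

lemma steklov_eigenfunction_mode:
  fixes g :: "'n::finite metric"
  assumes p: "profile l L r h" and g: "warp_metric L h g" and N: "CARD('n) \<ge> 3"
    and a: "\<And>t. t \<in> {l<..<r} \<Longrightarrow> (a has_real_derivative 1 / h t ^ (CARD('n) - 1) * q t) (at t)"
    and q: "\<And>t. t \<in> {l<..<r} \<Longrightarrow> (q has_real_derivative (real CARD('n) - 1) * h t ^ (CARD('n) - 3) * a t) (at t)"
    and bc: "- q 0 = \<sigma> * a 0" "q L = \<sigma> * a L" and nz: "a 0 \<noteq> 0"
  shows "steklov_eigenfunction L g \<sigma> (\<lambda>z. a (fst z) * snd z $ k)"
  unfolding steklov_eigenfunction_def
proof (intro conjI ballI allI impI)
  have P: "l < 0" "0 < L" "L < r" "h 0 = 1" "h L = 1" using p by (auto simp: profile_def)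
  have smooth: "C_k_on m {l<..<r} a" for m
  proof (rule conjunct1[OF C_k_on_linear_system])
    show "(a has_real_derivative (1 * inverse (h t ^ (CARD('n) - 1))) * q t) (at t)" if "t \<in> {l<..<r}" for t
      using a[OF that] by (simp add: divide_inverse)
    show "(q has_real_derivative ((real CARD('n) - 1) * h t ^ (CARD('n) - 3)) * a t) (at t)"
      if "t \<in> {l<..<r}" for t
      using q[OF that] .
  qed (rule profile_C_k_inverse[OF p] profile_C_k[OF p])+
  show "harmonic L g (\<lambda>z. a (fst z) * snd z $ k)"
    unfolding harmonic_def
  proof (intro conjI allI impI)
    show "smooth_near (cylinder L) (\<lambda>z::'n point. a (fst z) * snd z $ k)"
      using smooth P smooth_near_fst smooth_near_mult smooth_near_snd by blast
    fix x :: "real ^ 'n" assume "1 < norm x \<and> norm x < 1 + L"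
    then have x: "x \<in> open_annulus L" by (simp add: open_annulus_def)
    show "laplace_beltrami g (\<lambda>z. a (fst z) * snd z $ k) x = 0"
      by (rule laplace_beltrami_mode[OF g _ x _ _ _ N, where p = q and h' = "deriv h"])
        (use a q P profile_pos[OF p] profile_deriv[OF p] in auto)
  qed
  show "\<exists>z\<in>cylinder L. (\<lambda>z::'n point. a (fst z) * snd z $ k) z \<noteq> 0"
    using nz P by (intro bexI[of _ "(0, axis k 1)"]) (auto simp: cylinder_def norm_axis_1 axis_1_nth)
  fix z \<nu> assume z: "z \<in> {0, L} \<times> sphere 0 1" and "outward_unit_normal L g z \<nu>"
  then have \<nu>: "\<nu> = (if fst z = L then 1 else - 1, 0)"
    using outward_unit_normal_iff[OF g P(2) z] P by simp
  have zz: "fst z = 0 \<or> fst z = L" using z by auto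
  then have "(a has_derivative (*) (1 / h (fst z) ^ (CARD('n) - 1) * q (fst z))) (at (fst z))"
    using a[of "fst z"] P by (auto simp: has_field_derivative_def)
  note has_derivative_mult[OF has_derivative_compose[OF bounded_linear_imp_has_derivative[OF bounded_linear_fst] this]
      bounded_linear_imp_has_derivative[OF bounded_linear_compose[OF bounded_linear_vec_nth bounded_linear_snd], of k]]
  note D = this[THEN frechet_derivative_at, symmetric]
  have "- (q 0 * y) = \<sigma> * (a 0 * y)" "q L * y = \<sigma> * (a L * y)" for y
    using bc by (metis minus_mult_left mult.assoc)+
  with D
  show "frechet_derivative (\<lambda>z. a (fst z) * snd z $ k) (at z) \<nu> = \<sigma> * (a (fst z) * snd z $ k)"
    using zz P bc by (auto simp: \<nu>)
qed

lemma steklov_eigenfunction_const: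
  fixes g :: "'n::finite metric"
  assumes "profile l L r h" "warp_metric L h g"
  shows "steklov_eigenfunction L g 0 (\<lambda>z. 1)"
  using steklov_eigenfunction_radial[OF assms, of "\<lambda>_. 1" 0 0] by simp

text \<open>The constant supplies the eigenvalue 0, so one eigenfunction taking two different values
  completes an independent pair. Nonnegativity serves twice: the set under \<open>Inf\<close> must
  be bounded below, and 0 must not exceed \<sigma>.\<close>

lemma steklov_1_le:
  assumes nonneg: "\<And>\<tau> f. steklov_eigenfunction L g \<tau> f \<Longrightarrow> 0 \<le> \<tau>"
    and e: "steklov_eigenfunction L g 0 (\<lambda>z. 1)" "steklov_eigenfunction L g \<sigma> f"
    and zw: "z \<in> cylinder L" "w \<in> cylinder L" "f z \<noteq> f w"
  shows "steklov L g 1 \<le> \<sigma>"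
  unfolding steklov_def
proof (rule cInf_lower)
  show "bdd_below {s. \<exists>\<tau> f. (\<forall>i<Suc 1. steklov_eigenfunction L g (\<tau> i) (f i) \<and> \<tau> i \<le> s) \<and>
     lin_indep_on (cylinder L) (Suc 1) f}"
  proof (rule bdd_belowI[of _ 0])
    fix s assume "s \<in> {s. \<exists>\<tau> f. (\<forall>i<Suc 1. steklov_eigenfunction L g (\<tau> i) (f i) \<and> \<tau> i \<le> s) \<and>
      lin_indep_on (cylinder L) (Suc 1) f}"
    then obtain \<tau> f where "\<forall>i<Suc 1. steklov_eigenfunction L g (\<tau> i) (f i) \<and> \<tau> i \<le> s" by blast
    then have "steklov_eigenfunction L g (\<tau> 0) (f 0)" "\<tau> 0 \<le> s" by blast+
    then show "0 \<le> s" using nonneg order_trans by blast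
  qed
  define F where "F i = (if i = 0 then (\<lambda>z. 1) else f)" for i :: nat
  define T where "T i = (if i = 0 then 0 else \<sigma>)" for i :: nat
  have "c i = 0" if c: "\<forall>z\<in>cylinder L. (\<Sum>i<Suc 1. c i * F i z) = 0" and i: "i < Suc 1" for c i
  proof -
    have cz: "c 0 + c 1 * f z = 0" if "z \<in> cylinder L" for z
      using c that by (auto simp: F_def)
    have "c 1 * f z = c 1 * f w" using cz[OF zw(1)] cz[OF zw(2)] by linarith
    then have "c 1 = 0" using zw(3) by simp
    then show ?thesis using cz[OF zw(1)] i by (cases i) auto
  qed
  then have "lin_indep_on (cylinder L) (Suc 1) F" unfolding lin_indep_on_def by blast
  moreover have "\<forall>i<Suc 1. steklov_eigenfunction L g (T i) (F i) \<and> T i \<le> \<sigma>"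
    using e nonneg[OF e(2)] by (auto simp: T_def F_def)
  ultimately show "\<sigma> \<in> {s. \<exists>\<tau> f. (\<forall>i<Suc 1. steklov_eigenfunction L g (\<tau> i) (f i) \<and> \<tau> i \<le> s) \<and>
     lin_indep_on (cylinder L) (Suc 1) f}" by blast
qed

subsection \<open>The maximum principle\<close>

lemma antiderivative_on_open_interval:
  fixes f :: "real \<Rightarrow> real"
  assumes "continuous_on {l..r} f"
  shows "\<exists>a. \<forall>t\<in>{l<..<r}. (a has_real_derivative f t) (at t)"
proof -
  obtain a where a: "\<And>t. t \<in> {l..r} \<Longrightarrow> (a has_vector_derivative f t) (at t within {l..r})"
    using antiderivative_continuous[OF assms] by blast
  have "(a has_real_derivative f t) (at t)" if "t \<in> {l<..<r}" for t
    using a[of t] that by (simp add: has_real_derivative_iff_has_vector_derivative at_within_Icc_at)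
  then show ?thesis by blast
qed

section \<open>Second-order conditions at an interior maximum\<close>

lemma second_derivative_nonpos_at_max:
  fixes \<phi> :: "real \<Rightarrow> real"
  assumes "\<delta> > 0" "\<And>t. \<bar>t\<bar> < \<delta> \<Longrightarrow> (\<phi> has_real_derivative \<phi>' t) (at t)"
    "(\<phi>' has_real_derivative D) (at 0)" "\<And>t. \<bar>t\<bar> < \<delta> \<Longrightarrow> \<phi> t \<le> \<phi> 0" "\<phi>' 0 = 0"
  shows "D \<le> 0"
proof (rule ccontr)
  assume "\<not> D \<le> 0"
  then obtain d where d: "d > 0" "\<And>t. 0 < t \<Longrightarrow> t < d \<Longrightarrow> \<phi>' 0 < \<phi>' (0 + t)"
    using DERIV_pos_inc_right[OF assms(3)] by auto
  define t where "t = min d \<delta> / 2"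
  have t: "0 < t" "t < d" "t < \<delta>" using d assms(1) by (auto simp: t_def min_def)
  have "\<exists>s. 0 < s \<and> s < t \<and> \<phi> t - \<phi> 0 = (t - 0) * \<phi>' s"
    using t assms(2) by (intro MVT2) auto
  then obtain s where s: "0 < s" "s < t" "\<phi> t - \<phi> 0 = (t - 0) * \<phi>' s" by blast
  then have "\<phi> t - \<phi> 0 > 0" using d(2)[of s] t assms(5) by simp
  then show False using assms(4)[of t] t by simp
qed

lemma hessian_nonpos_at_max:
  fixes u :: "real ^ 'n::finite \<Rightarrow> real"
  assumes U: "open U" "x \<in> U" and u: "\<And>y. y \<in> U \<Longrightarrow> (u has_derivative u' y) (at y)"
    and D: "\<And>j. ((\<lambda>y. u' y (axis j 1)) has_derivative D j) (at x)"
    and max: "\<And>y. y \<in> U \<Longrightarrow> u y \<le> u x"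
  shows "(\<Sum>j\<in>UNIV. v $ j * D j v) \<le> 0"
proof -
  obtain e where e: "e > 0" "ball x e \<subseteq> U" using U open_contains_ball by blast
  define \<delta> where "\<delta> = e / (norm v + 1)"
  have np: "norm v + 1 > 0" by (simp add: add_nonneg_pos)
  then have \<delta>: "\<delta> > 0" using e by (simp add: \<delta>_def)
  have inU: "x + t *\<^sub>R v \<in> U" if "\<bar>t\<bar> < \<delta>" for t
  proof -
    have "\<bar>t\<bar> * norm v \<le> \<bar>t\<bar> * (norm v + 1)" by (intro mult_left_mono) auto
    also have "\<bar>t\<bar> * (norm v + 1) < e"
      using that np unfolding \<delta>_def by (simp only: pos_less_divide_eq)
    finally have "x + t *\<^sub>R v \<in> ball x e" by (simp add: dist_norm)
    then show ?thesis using e by blast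
  qed
  have line: "((\<lambda>t. x + t *\<^sub>R v) has_derivative (\<lambda>t. t *\<^sub>R v)) (at t)" for t
    by (auto intro!: derivative_eq_intros)
  have expand: "u' y v = (\<Sum>j\<in>UNIV. v $ j * u' y (axis j 1))" if "y \<in> U" for y
  proof -
    have l: "linear (u' y)" using u[OF that] has_derivative_linear by blast
    have "u' y v = u' y (\<Sum>j\<in>UNIV. v $ j *\<^sub>R axis j 1)"
      using basis_expansion[of v] by (simp add: scalar_mult_eq_scaleR)
    then show ?thesis by (simp add: linear_sum[OF l] linear_scale[OF l])
  qed
  have d1: "((\<lambda>t. u (x + t *\<^sub>R v)) has_real_derivative (\<Sum>j\<in>UNIV. v $ j * u' (x + t *\<^sub>R v) (axis j 1))) (at t)"
    if "\<bar>t\<bar> < \<delta>" for t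
  proof -
    have l: "linear (u' (x + t *\<^sub>R v))" using u[OF inU[OF that]] has_derivative_linear by blast
    have "((\<lambda>t. u (x + t *\<^sub>R v)) has_derivative (\<lambda>s. u' (x + t *\<^sub>R v) (s *\<^sub>R v))) (at t)"
      using has_derivative_compose[OF line u[OF inU[OF that]]] .
    then have "((\<lambda>t. u (x + t *\<^sub>R v)) has_real_derivative u' (x + t *\<^sub>R v) v) (at t)"
      by (rule has_derivative_imp_has_field_derivative) (simp add: linear_scale[OF l])
    then show ?thesis unfolding expand[OF inU[OF that]] .
  qed
  have d2: "((\<lambda>t. \<Sum>j\<in>UNIV. v $ j * u' (x + t *\<^sub>R v) (axis j 1)) has_real_derivative (\<Sum>j\<in>UNIV. v $ j * D j v)) (at 0)"
  proof (intro DERIV_sum)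
    fix j :: 'n
    have D0: "((\<lambda>y. u' y (axis j 1)) has_derivative D j) (at (x + 0 *\<^sub>R v))" using D by simp
    have l: "linear (D j)" using D has_derivative_linear by blast
    have "((\<lambda>t. u' (x + t *\<^sub>R v) (axis j 1)) has_derivative (\<lambda>s. D j (s *\<^sub>R v))) (at 0)"
      using has_derivative_compose[OF line D0] .
    then have "((\<lambda>t. u' (x + t *\<^sub>R v) (axis j 1)) has_real_derivative D j v) (at 0)"
      by (rule has_derivative_imp_has_field_derivative) (simp add: linear_scale[OF l])
    then show "((\<lambda>t. v $ j * u' (x + t *\<^sub>R v) (axis j 1)) has_real_derivative v $ j * D j v) (at 0)"
      by (rule DERIV_cmult)
  qed
  have "u' x = (\<lambda>v. 0)"
    using differential_zero_maxmin[OF U(2) U(1) u[OF U(2)]] max by blast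
  then show ?thesis
    using max inU by (intro second_derivative_nonpos_at_max[OF \<delta> d1 d2]) auto
qed

text \<open>The coefficient matrix is a multiple of \<open>S\<^sup>2\<close> with \<open>S = s I + (1 - s) p p\<^sup>T\<close> symmetric, hence the
  trace of its product with a negative semidefinite matrix \<open>H\<close> is a multiple of the trace of \<open>S H S\<close>.\<close>

lemma stretch_trace_nonpos:
  fixes D :: "'n::finite \<Rightarrow> real ^ 'n \<Rightarrow> real"
  assumes lin: "\<And>j. linear (D j)" and neg: "\<And>v. (\<Sum>j\<in>UNIV. v $ j * D j v) \<le> 0" and p: "norm p = 1"
  shows "(\<Sum>i\<in>UNIV. \<Sum>j\<in>UNIV. stretch_matrix (s\<^sup>2) p $ i $ j * D j (axis i 1)) \<le> 0"
proof -
  define b where "b v w = (\<Sum>j\<in>UNIV. w $ j * D j v)" for v w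
  have b1: "b (s *\<^sub>R v + t *\<^sub>R v') w = s * b v w + t * b v' w" for s t v v' w
    unfolding b_def sum_distrib_left sum.distrib[symmetric]
    by (rule sum.cong) (simp_all add: linear_add[OF lin] linear_scale[OF lin] algebra_simps)
  have b2: "b w (s *\<^sub>R v + t *\<^sub>R v') = s * b w v + t * b w v'" for s t v v' w
    unfolding b_def sum_distrib_left sum.distrib[symmetric]
    by (rule sum.cong) (simp_all add: algebra_simps)
  have b_axis: "b v (axis i 1) = D i v" for i v
    by (simp add: b_def axis_1_nth if_distrib[of "\<lambda>a. a * _"] cong: if_cong)
  have sum1: "(\<Sum>i\<in>UNIV. p $ i * b (axis i 1) w) = b p w" for w
  proof -
    have "D j p = (\<Sum>i\<in>UNIV. p $ i * D j (axis i 1))" for j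
    proof -
      have "D j p = D j (\<Sum>i\<in>UNIV. p $ i *\<^sub>R axis i 1)"
        using basis_expansion[of p] by (simp add: scalar_mult_eq_scaleR)
      then show ?thesis by (simp add: linear_sum[OF lin] linear_scale[OF lin])
    qed
    then have "b p w = (\<Sum>j\<in>UNIV. \<Sum>i\<in>UNIV. w $ j * (p $ i * D j (axis i 1)))"
      by (simp add: b_def sum_distrib_left)
    also have "\<dots> = (\<Sum>i\<in>UNIV. p $ i * b (axis i 1) w)"
      unfolding b_def sum_distrib_left by (subst sum.swap) (simp add: mult.left_commute)
    finally show ?thesis ..
  qed
  have sum2: "(\<Sum>i\<in>UNIV. p $ i * b w (axis i 1)) = b w p" for w
    unfolding b_axis by (simp add: b_def)
  \<comment> \<open>\<open>e i\<close> is the \<open>i\<close>-th column of \<open>S\<close>, so the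
    trace becomes a sum of values of the quadratic form at the \<open>e i\<close>.\<close>
  define e where "e i = s *\<^sub>R axis i 1 + ((1 - s) * p $ i) *\<^sub>R p" for i :: 'n
  have "b (e i) (e i) = s\<^sup>2 * b (axis i 1) (axis i 1) + s * (1 - s) * (p $ i * b (axis i 1) p)
      + s * (1 - s) * (p $ i * b p (axis i 1)) + (1 - s)\<^sup>2 * b p p * (p $ i * p $ i)" for i
    unfolding e_def b1 b2 by (simp add: power2_eq_square algebra_simps)
  then have "(\<Sum>i\<in>UNIV. b (e i) (e i)) = s\<^sup>2 * (\<Sum>i\<in>UNIV. b (axis i 1) (axis i 1)) + s * (1 - s) * b p p
      + s * (1 - s) * b p p + (1 - s)\<^sup>2 * b p p"
    by (simp add: sum.distrib sum_distrib_left[symmetric] sum1 sum2 sum_component_sq[OF p])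
  also have "\<dots> = (\<Sum>i\<in>UNIV. (1 - s\<^sup>2) * (p $ i * b (axis i 1) p) + s\<^sup>2 * b (axis i 1) (axis i 1))"
    unfolding sum.distrib sum_distrib_left[symmetric] sum1 by (simp add: power2_eq_square algebra_simps)
  also have "\<dots> = (\<Sum>i\<in>UNIV. \<Sum>j\<in>UNIV. stretch_matrix (s\<^sup>2) p $ i $ j * D j (axis i 1))"
    unfolding stretch_matrix_apply b_axis by (simp add: b_def mult.assoc)
  finally have "(\<Sum>i\<in>UNIV. \<Sum>j\<in>UNIV. stretch_matrix (s\<^sup>2) p $ i $ j * D j (axis i 1)) = (\<Sum>i\<in>UNIV. b (e i) (e i))" ..
  also have "\<dots> \<le> 0" using neg by (intro sum_nonpos) (auto simp: b_def)
  finally show ?thesis .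
qed

section \<open>The Laplacian in divergence form on the annulus\<close>

lemma C_k_on_param:
  fixes V :: "(real ^ 'n::finite) set"
  assumes "0 \<notin> V" "open U" "C_k_on k U f" "param ` V \<subseteq> U"
  shows "C_k_on k V (f \<circ> param)"
proof -
  have "C_k_on k V (\<lambda>x. param x \<bullet> b)" for b :: "'n point"
  proof -
    have "C_k_on k V (\<lambda>x. (norm x + (- 1)) * fst b + inverse (norm x) * (x \<bullet> snd b))"
      using assms(1) by (intro C_k_on_add C_k_on_mult C_k_on_const C_k_on_norm C_k_on_inverse
        C_k_on_bounded_linear[OF bounded_linear_inner_left]) auto
    then show ?thesis by (simp add: param_def inner_prod_def)
  qed
  then show ?thesis unfolding o_def
    by (intro C_k_on_compose[OF assms(2,3)] assms(4))
qed

lemma C_k_on_diffusion_coeff: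
  assumes p: "profile l L r h"
  shows "C_k_on k (open_annulus L :: (real ^ 'n::finite) set) (\<lambda>x. diffusion_coeff h x i j)"
proof -
  define A :: "(real ^ 'n) set" where "A = open_annulus L"
  have n0: "x \<noteq> 0" "norm x - 1 \<in> {l<..<r}" "h (norm x - 1) \<noteq> 0" if "x \<in> A" for x
  proof -
    have "1 < norm x" "norm x < 1 + L" using that by (auto simp: A_def open_annulus_def)
    moreover have "l < 0" "L < r" using p by (auto simp: profile_def)
    ultimately show "x \<noteq> 0" "norm x - 1 \<in> {l<..<r}" "h (norm x - 1) \<noteq> 0"
      using profile_pos[OF p, of "norm x - 1"] by auto
  qed
  have norm: "C_k_on k A norm" using n0(1) by (intro C_k_on_norm) auto
  then have inorm: "C_k_on k A (\<lambda>x. inverse (norm x))" using n0 by (intro C_k_on_inverse) auto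
  have "C_k_on k A (\<lambda>x. norm x + (- 1))" by (intro C_k_on_add norm C_k_on_const)
  then have H: "C_k_on k A (\<lambda>x. h (norm x - 1))"
    using profile_C_k[OF p, of k 1 1] n0(2)
    by (intro C_k_on_compose[of "{l<..<r}" k h A "\<lambda>x. norm x - 1"]) auto
  then have iH: "C_k_on k A (\<lambda>x. inverse (h (norm x - 1)))" using n0 by (intro C_k_on_inverse) auto
  have c: "C_k_on k A (\<lambda>x. x $ m)" for m
    by (intro C_k_on_bounded_linear bounded_linear_vec_nth)
  have "C_k_on k A (\<lambda>x. (h (norm x - 1) * inverse (norm x)) ^ (CARD('n) - 1) *
     ((x $ i * inverse (norm x)) * (x $ j * inverse (norm x)) + (norm x * inverse (h (norm x - 1)))\<^sup>2 *
        ((if i = j then 1 else 0) + (- 1) * ((x $ i * inverse (norm x)) * (x $ j * inverse (norm x))))))"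
    by (intro C_k_on_add C_k_on_mult C_k_on_power C_k_on_const norm inorm H iH c)
  then show ?thesis unfolding diffusion_coeff_def stretch_matrix_def sgn_vec_nth A_def
    by (simp add: divide_inverse)
qed

text \<open>The Laplacian before division by the density \<open>sqrt (det G)\<close>; the positive
  factor left out does not affect the signs on which the maximum principle depends.\<close>

definition flux_div :: "(real \<Rightarrow> real) \<Rightarrow> (real ^ 'n::finite \<Rightarrow> real) \<Rightarrow> real ^ 'n \<Rightarrow> real" where
  "flux_div h u x = (\<Sum>i\<in>UNIV. partial i (\<lambda>y. \<Sum>j\<in>UNIV. diffusion_coeff h y i j * partial j u y) x)"

lemma C_k_on_partial:
  "open U \<Longrightarrow> C_k_on (Suc k) U u \<Longrightarrow> C_k_on k U (partial j u)"
  unfolding partial_def by (intro C_k_on_frechet) auto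

lemma C_k_on_flux:
  assumes "profile l L r h" "C_k_on 2 (open_annulus L) u"
  shows "C_k_on (Suc 0) (open_annulus L) (\<lambda>y. \<Sum>j\<in>UNIV. diffusion_coeff h y i j * partial j u y)"
proof (intro C_k_on_sum C_k_on_mult C_k_on_diffusion_coeff[OF assms(1)] C_k_on_partial[OF open_open_annulus])
  show "C_k_on (Suc (Suc 0)) (open_annulus L) u" using assms(2) by (simp only: numeral_2_eq_2)
qed

text \<open>\<open>partial\<close> is sure to be additive only at points of differentiability, and
  it is applied twice, the second time to the flux; hence the regularity of order 2.\<close>

lemma flux_div_linear:
  fixes u v :: "real ^ 'n::finite \<Rightarrow> real"
  assumes p: "profile l L r h" and u: "C_k_on 2 (open_annulus L) u" and v: "C_k_on 2 (open_annulus L) v"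
    and x: "x \<in> open_annulus L"
  shows "flux_div h (\<lambda>y. s * u y + t * v y) x = s * flux_div h u x + t * flux_div h v x"
proof -
  have d: "(f has_derivative frechet_derivative f (at y)) (at y)"
    if "C_k_on (Suc k) (open_annulus L) f" "y \<in> open_annulus L" for f :: "real ^ 'n \<Rightarrow> real" and y k
    using C_k_on_has_derivative[OF that] .
  have lin: "partial j (\<lambda>y. s * f y + t * w y) y = s * partial j f y + t * partial j w y"
    if "C_k_on (Suc k) (open_annulus L) f" "C_k_on (Suc k) (open_annulus L) w" "y \<in> open_annulus L"
    for f w :: "real ^ 'n \<Rightarrow> real" and y k j
  proof -
    have "((\<lambda>y. s * f y + t * w y) has_derivative
        (\<lambda>z. s * frechet_derivative f (at y) z + t * frechet_derivative w (at y) z)) (at y)"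
      by (intro has_derivative_add has_derivative_mult_right d[OF that(1,3)] d[OF that(2,3)])
    from partialI[OF this] show ?thesis by (simp add: partial_def)
  qed
  let ?F = "\<lambda>u i y. \<Sum>j\<in>UNIV. diffusion_coeff h y i j * partial j u y"
  have "partial i (?F (\<lambda>y. s * u y + t * v y) i) x = s * partial i (?F u i) x + t * partial i (?F v i) x" for i
  proof -
    have "partial i (?F (\<lambda>y. s * u y + t * v y) i) x = partial i (\<lambda>y. s * ?F u i y + t * ?F v i y) x"
    proof (rule partial_cong[OF open_open_annulus x])
      fix y :: "real ^ 'n" assume y: "y \<in> open_annulus L"
      show "?F (\<lambda>y. s * u y + t * v y) i y = s * ?F u i y + t * ?F v i y"
        using lin[OF u[unfolded numeral_2_eq_2] v[unfolded numeral_2_eq_2] y]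
        by (simp add: sum_distrib_left sum.distrib[symmetric] algebra_simps)
    qed
    also have "\<dots> = s * partial i (?F u i) x + t * partial i (?F v i) x"
      by (rule lin[OF C_k_on_flux[OF p u] C_k_on_flux[OF p v] x])
    finally show ?thesis .
  qed
  then show ?thesis by (simp add: flux_div_def sum.distrib sum_distrib_left)
qed

text \<open>The gradient vanishes at the maximum, so the derivatives of the coefficients drop out
  and the trace of the coefficient matrix against the Hessian remains.\<close>

lemma flux_div_nonpos_at_max:
  fixes u :: "real ^ 'n::finite \<Rightarrow> real"
  assumes p: "profile l L r h" and u: "C_k_on 2 (open_annulus L) u" and x: "x \<in> open_annulus L"
    and max: "\<And>y. y \<in> open_annulus L \<Longrightarrow> u y \<le> u x"
  shows "flux_div h u x \<le> 0"
proof -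
  define D where "D j = frechet_derivative (partial j u) (at x)" for j
  have u': "C_k_on (Suc (Suc 0)) (open_annulus L) u" using u by (simp only: numeral_2_eq_2)
  have pu: "(partial j u has_derivative D j) (at x)" for j
    unfolding D_def by (rule C_k_on_has_derivative[OF C_k_on_partial[OF open_open_annulus u'] x])
  have du: "(u has_derivative frechet_derivative u (at y)) (at y)" if "y \<in> open_annulus L" for y
    by (rule C_k_on_has_derivative[OF u' that])
  have "frechet_derivative u (at x) = (\<lambda>v. 0)"
    using differential_zero_maxmin[OF x open_open_annulus du[OF x]] max by blast
  then have p0: "partial j u x = 0" for j by (simp add: partial_def)
  have hess: "(\<Sum>j\<in>UNIV. v $ j * D j v) \<le> 0" for v
    by (rule hessian_nonpos_at_max[OF open_open_annulus x du _ max]) (use pu in \<open>simp_all add: partial_def[abs_def]\<close>)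
  have lin: "linear (D j)" for j using pu has_derivative_linear by blast
  define A' where "A' i j = frechet_derivative (\<lambda>y. diffusion_coeff h y i j) (at x)" for i j
  have A': "((\<lambda>y. diffusion_coeff h y i j) has_derivative A' i j) (at x)" for i j
    unfolding A'_def by (rule C_k_on_has_derivative[OF C_k_on_diffusion_coeff[OF p] x])
  have "partial i (\<lambda>y. \<Sum>j\<in>UNIV. diffusion_coeff h y i j * partial j u y) x
     = (\<Sum>j\<in>UNIV. diffusion_coeff h x i j * D j (axis i 1))" for i
  proof -
    have "((\<lambda>y. \<Sum>j\<in>UNIV. diffusion_coeff h y i j * partial j u y) has_derivative
      (\<lambda>v. \<Sum>j\<in>UNIV. diffusion_coeff h x i j * D j v + A' i j v * partial j u x)) (at x)"
      by (intro has_derivative_sum has_derivative_mult A' pu)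
    from partialI[OF this] show ?thesis by (simp add: p0)
  qed
  then have "flux_div h u x = (h (norm x - 1) / norm x) ^ (CARD('n) - 1) *
     (\<Sum>i\<in>UNIV. \<Sum>j\<in>UNIV. stretch_matrix ((norm x / h (norm x - 1))\<^sup>2) (sgn x) $ i $ j * D j (axis i 1))"
    by (simp add: flux_div_def diffusion_coeff_def sum_distrib_left mult.assoc)
  also have "\<dots> \<le> 0"
  proof (rule mult_nonneg_nonpos)
    have "h (norm x - 1) > 0" "x \<noteq> 0" using x profile_pos[OF p, of "norm x - 1"] by (auto simp: open_annulus_def)
    then show "0 \<le> (h (norm x - 1) / norm x) ^ (CARD('n) - 1)" by simp
    show "(\<Sum>i\<in>UNIV. \<Sum>j\<in>UNIV. stretch_matrix ((norm x / h (norm x - 1))\<^sup>2) (sgn x) $ i $ j * D j (axis i 1)) \<le> 0"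
      using \<open>x \<noteq> 0\<close> by (intro stretch_trace_nonpos lin hess) (simp add: norm_sgn)
  qed
  finally show ?thesis .
qed

lemma harmonic_flux_div:
  fixes g :: "'n::finite metric"
  assumes p: "profile l L r h" and g: "warp_metric L h g" and x: "x \<in> open_annulus L"
  shows "flux_div h (f \<circ> param) x = laplace_beltrami g f x * (h (norm x - 1) / norm x) ^ (CARD('n) - 1)"
proof -
  have "h (norm x - 1) > 0" "norm x > 0" using x profile_pos[OF p, of "norm x - 1"] by (auto simp: open_annulus_def)
  then have "(h (norm x - 1) / norm x) ^ (CARD('n) - 1) \<noteq> 0" by simp
  then show ?thesis
    using profile_pos[OF p] by (subst laplace_beltrami_warp[OF g _ x]) (auto simp: flux_div_def)
qed

section \<open>Boundary maxima and the sign of the eigenvalues\<close>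

lemma derivative_nonneg_at_right_end_max:
  fixes \<phi> :: "real \<Rightarrow> real"
  assumes "(\<phi> has_real_derivative D) (at b)" "a < b" "\<And>t. t \<in> {a..b} \<Longrightarrow> \<phi> t \<le> \<phi> b"
  shows "0 \<le> D"
proof (rule ccontr)
  assume "\<not> 0 \<le> D"
  then obtain d where d: "d > 0" "\<And>s. 0 < s \<Longrightarrow> s < d \<Longrightarrow> \<phi> b < \<phi> (b - s)"
    using DERIV_neg_dec_left[OF assms(1)] by auto
  define s where "s = min d (b - a) / 2"
  have "0 < s" "s < d" "s \<le> b - a" using d assms(2) by (auto simp: s_def min_def)
  then show False using d(2)[of s] assms(3)[of "b - s"] by auto
qed

lemma derivative_nonpos_at_left_end_max:
  fixes \<phi> :: "real \<Rightarrow> real"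
  assumes "(\<phi> has_real_derivative D) (at a)" "a < b" "\<And>t. t \<in> {a..b} \<Longrightarrow> \<phi> t \<le> \<phi> a"
  shows "D \<le> 0"
proof -
  have "(\<phi> has_real_derivative D) (at (- (- a)))" using assms(1) by simp
  then have "((\<lambda>t. \<phi> (- t)) has_real_derivative - D) (at (- a))"
    by (simp only: DERIV_mirror[symmetric] minus_minus)
  then have "0 \<le> - D" using assms by (intro derivative_nonneg_at_right_end_max[of "\<lambda>t. \<phi> (- t)" "- D" "- a" "- b"]) auto
  then show ?thesis by simp
qed

text \<open>At a boundary maximum the outward derivative is nonnegative, which is incompatible with
  \<open>\<sigma> < 0\<close> if the function is positive there. The perturbation that rules out
  interior maxima adds errors of order \<epsilon>, beaten by the choice of \<epsilon>.\<close>

lemma steklov_eigenvalue_nonneg: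
  fixes g :: "'n::finite metric"
  assumes p: "profile l L r h" and g: "warp_metric L h g" and ef: "steklov_eigenfunction L g \<sigma> f"
  shows "0 \<le> \<sigma>"
proof -
  define k where "k = CARD('n) - 1"
  have P: "l < 0" "0 < L" "L < r" "h 0 = 1" "h L = 1" using p by (auto simp: profile_def)
  have harm: "harmonic L g f" using ef by (simp add: steklov_eigenfunction_def)
  obtain U where U: "open U" "cylinder L \<subseteq> U" "\<And>k. C_k_on k U f"
    using harm unfolding harmonic_def smooth_near_def by blast
  obtain z1 where z1: "z1 \<in> cylinder L" "f z1 \<noteq> 0" using ef by (auto simp: steklov_eigenfunction_def)
  define s where "s = sgn (f z1)"
  define m where "m = s * f z1"
  have m: "m > 0" using z1 by (simp add: m_def s_def sgn_if)
  \<comment> \<open>\<open>(h\<^sup>k \<psi>')' = 1\<close>, so adding \<open>\<epsilon> \<psi>\<close> makes \<open>f\<close> strictly subharmonic.\<close>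
  have cont: "continuous_on {l..r} (\<lambda>t. t * inverse (h t ^ k))"
    using p unfolding profile_def by (intro continuous_intros) force+
  obtain \<psi> where \<psi>: "\<And>t. t \<in> {l<..<r} \<Longrightarrow> (\<psi> has_real_derivative t * inverse (h t ^ k)) (at t)"
    using antiderivative_on_open_interval[OF cont] by blast
  have \<psi>_C: "C_k_on j {l<..<r} \<psi>" for j
  proof (rule C_k_on_SucD, rule C_k_on_SucI_real[OF \<psi>])
    have "C_k_on j {l<..<r} (\<lambda>t. t * (1 * inverse (h t ^ k)))"
      by (intro C_k_on_mult[OF _ profile_C_k_inverse[OF p]] C_k_on_bounded_linear bounded_linear_ident)
    then show "C_k_on j {l<..<r} (\<lambda>t. t * inverse (h t ^ k))" by simp
  qed
  have "continuous_on {l<..<r} \<psi>" using \<psi>_C[of 0] by simp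
  then have \<psi>c: "continuous_on {0..L} \<psi>" by (rule continuous_on_subset) (use P in auto)
  then have "bounded (\<psi> ` {0..L})" by (intro compact_imp_bounded compact_continuous_image) auto
  then obtain K where K: "\<And>t. t \<in> {0..L} \<Longrightarrow> norm (\<psi> t) \<le> K" unfolding bounded_iff by blast
  have K0: "K \<ge> 0" using K[of 0] P norm_ge_zero[of "\<psi> 0"] by auto
  have open_annulus_sub: "param ` (open_annulus L :: (real ^ 'n) set) \<subseteq> cylinder L"
    using param_in_cylinder by (force simp: open_annulus_def)
  have zero: "0 \<notin> (open_annulus L :: (real ^ 'n) set)" by (simp add: open_annulus_def)
  have u2: "C_k_on 2 (open_annulus L) (f \<circ> param)"
    by (rule C_k_on_param[OF zero U(1,3)]) (use open_annulus_sub U(2) in blast)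
  have \<psi>2: "C_k_on 2 (open_annulus L) ((\<lambda>z::'n point. \<psi> (fst z)) \<circ> param)"
  proof (rule C_k_on_param[OF zero])
    show "open ({l<..<r} \<times> (UNIV :: (real ^ 'n) set))" by (intro open_Times) auto
    show "C_k_on 2 ({l<..<r} \<times> UNIV) (\<lambda>z::'n point. \<psi> (fst z))"
      by (rule C_k_on_compose[OF _ \<psi>_C]) (auto intro!: C_k_on_bounded_linear bounded_linear_fst)
    show "param ` open_annulus L \<subseteq> {l<..<r} \<times> (UNIV :: (real ^ 'n) set)"
      using open_annulus_sub P by (fastforce simp: cylinder_def)
  qed
  have f_der: "(f has_derivative frechet_derivative f (at z)) (at z)" if "z \<in> cylinder L" for z
    by (rule C_k_on_has_derivative[OF U(3)]) (use that U(2) in blast)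
  have fc: "continuous_on (cylinder L) f" using U(3)[of 0] U(2) continuous_on_subset by auto
  \<comment> \<open>The first estimate compares the maximum with the value at \<open>z1\<close>, at
    the cost of twice the bound \<open>K\<close> on \<psi>. In the second,
    \<open>\<epsilon> * L\<close> comes from the derivative of \<psi>, which is \<open>L\<close> at
    the right end and 0 at the left.\<close>
  have key: "s * f z0 \<ge> m - 2 * K * \<epsilon> \<and> \<sigma> * (s * f z0) + \<epsilon> * L \<ge> 0" if "\<epsilon> > 0"
    and z0: "z0 \<in> cylinder L" "\<forall>z\<in>cylinder L. s * f z + \<epsilon> * \<psi> (fst z) \<le> s * f z0 + \<epsilon> * \<psi> (fst z0)"
    for \<epsilon> z0
  proof -
    obtain r0 p0 where rp: "z0 = (r0, p0)" "0 \<le> r0" "r0 \<le> L" "norm p0 = 1"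
      using z0(1) by (cases z0) (auto simp: cylinder_def)
    have bdry: "r0 = 0 \<or> r0 = L"
    proof (rule ccontr)
      assume "\<not> ?thesis"
      then have r0: "0 < r0" "r0 < L" using rp by auto
      define x where "x = (1 + r0) *\<^sub>R p0"
      have nx: "norm x = 1 + r0" using rp by (simp add: x_def)
      then have x: "x \<in> open_annulus L" using r0 by (simp add: open_annulus_def)
      have px: "param x = z0" using r0 nx by (simp add: param_def rp(1)) (simp add: x_def)
      have max: "s * (f \<circ> param) y + \<epsilon> * ((\<lambda>z. \<psi> (fst z)) \<circ> param) y
          \<le> s * (f \<circ> param) x + \<epsilon> * ((\<lambda>z. \<psi> (fst z)) \<circ> param) x" if "y \<in> open_annulus L" for y
      proof -
        have "param y \<in> cylinder L" using open_annulus_sub that by blast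
        then show ?thesis using z0(2) px by simp
      qed
      have "C_k_on 2 (open_annulus L) (\<lambda>y. s * (f \<circ> param) y + \<epsilon> * ((\<lambda>z. \<psi> (fst z)) \<circ> param) y)"
        by (intro C_k_on_add C_k_on_mult C_k_on_const u2 \<psi>2)
      from flux_div_nonpos_at_max[OF p this x max]
      have "s * flux_div h (f \<circ> param) x + \<epsilon> * flux_div h ((\<lambda>z. \<psi> (fst z)) \<circ> param) x \<le> 0"
        unfolding flux_div_linear[OF p u2 \<psi>2 x] by simp
      moreover have "flux_div h (f \<circ> param) x = 0"
        using harm x unfolding harmonic_flux_div[OF p g x] harmonic_def by (simp add: open_annulus_def)
      moreover have "laplace_beltrami g (\<lambda>z. \<psi> (fst z)) x = 1 / h (norm x - 1) ^ (CARD('n) - 1)"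
        by (rule laplace_beltrami_radial[OF g _ x, where p = "\<lambda>t. t" and p' = "\<lambda>t. 1"])
          (use \<psi> P profile_pos[OF p] in \<open>auto simp: k_def divide_inverse intro!: derivative_eq_intros\<close>)
      then have "flux_div h ((\<lambda>z. \<psi> (fst z)) \<circ> param) x > 0"
        using r0 nx profile_pos[OF p, of r0] unfolding harmonic_flux_div[OF p g x] by simp
      ultimately show False using \<open>\<epsilon> > 0\<close> mult_pos_pos[of \<epsilon>] by fastforce
    qed
    have zb: "z0 \<in> {0, L} \<times> sphere 0 1" using rp bdry by auto
    define D where "D = frechet_derivative f (at z0)"
    have fD: "(f has_derivative D) (at (r0, p0))" using f_der[OF z0(1)] rp by (simp add: D_def)
    have lin: "linear D" using fD has_derivative_linear by blast
    have "((\<lambda>t. (t, p0)) has_derivative (\<lambda>t. (t, 0))) (at r0)"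
      by (intro has_derivative_Pair has_derivative_ident has_derivative_const)
    from has_derivative_compose[OF this fD]
    have "((\<lambda>t. f (t, p0)) has_real_derivative D (1, 0)) (at r0)"
    proof (rule has_derivative_imp_has_field_derivative)
      show "y * D (1, 0) = D (y, 0)" for y using linear_scale[OF lin, of y "(1, 0)"] by simp
    qed
    then have \<phi>: "((\<lambda>t. s * f (t, p0) + \<epsilon> * \<psi> t) has_real_derivative
        s * D (1, 0) + \<epsilon> * (r0 * inverse (h r0 ^ k))) (at r0)"
      using \<psi>[of r0] rp P by (intro DERIV_add DERIV_cmult) auto
    have max: "s * f (t, p0) + \<epsilon> * \<psi> t \<le> s * f (r0, p0) + \<epsilon> * \<psi> r0" if "t \<in> {0..L}" for t
      using z0(2) that rp by (force simp: cylinder_def)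
    have "outward_unit_normal L g z0 (if fst z0 = L then 1 else - 1, 0)"
      using outward_unit_normal_iff[OF g P(2) zb] P by simp
    then have ev: "D (if r0 = L then 1 else - 1, 0) = \<sigma> * f z0"
      using ef zb rp unfolding steklov_eigenfunction_def D_def by auto
    have "\<sigma> * (s * f z0) + \<epsilon> * L \<ge> 0"
      using bdry
    proof
      assume r0: "r0 = L"
      then have "0 \<le> s * D (1, 0) + \<epsilon> * (r0 * inverse (h r0 ^ k))"
        using derivative_nonneg_at_right_end_max[OF \<phi>, of 0] max P by simp
      then show ?thesis using ev r0 P by (simp add: mult.left_commute)
    next
      assume r0: "r0 = 0"
      then have "s * D (1, 0) + \<epsilon> * (r0 * inverse (h r0 ^ k)) \<le> 0"
        using derivative_nonpos_at_left_end_max[OF \<phi>, of L] max P by simp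
      moreover have "D (- 1, 0) = - D (1, 0)" using linear_neg[OF lin, of "(1, 0)"] by simp
      then have "D (1, 0) = - (\<sigma> * f z0)" using ev r0 P by simp
      ultimately have "0 \<le> s * (\<sigma> * f z0)" using r0 by simp
      moreover have "\<epsilon> * L \<ge> 0" using \<open>\<epsilon> > 0\<close> P by simp
      ultimately show ?thesis by (simp add: mult.left_commute)
    qed
    moreover have "s * f z0 \<ge> m - 2 * K * \<epsilon>"
    proof -
      have "\<psi> (fst z1) \<ge> - K" "\<psi> r0 \<le> K"
        using K[of "fst z1"] K[of r0] z1 rp by (auto simp: cylinder_def)
      then have "\<epsilon> * (- K) \<le> \<epsilon> * \<psi> (fst z1)" "\<epsilon> * \<psi> r0 \<le> \<epsilon> * K"
        using \<open>\<epsilon> > 0\<close> by (intro mult_left_mono; simp)+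
      moreover have "m + \<epsilon> * \<psi> (fst z1) \<le> s * f z0 + \<epsilon> * \<psi> r0"
        using z0(2) z1(1) rp by (auto simp: m_def)
      moreover have "2 * K * \<epsilon> = \<epsilon> * K - \<epsilon> * (- K)" by simp
      ultimately show ?thesis by linarith
    qed
    ultimately show ?thesis by blast
  qed
  show "0 \<le> \<sigma>"
  proof (rule ccontr)
    assume "\<not> 0 \<le> \<sigma>"
    then have neg: "\<sigma> < 0" by simp
    \<comment> \<open>\<open>Q\<close> collects both errors: the estimates in \<open>key\<close>
      combine to \<open>\<sigma> * m + \<epsilon> * Q \<ge> 0\<close>, while \<epsilon> is chosen to
      make \<open>\<epsilon> * Q\<close> half of \<open>- \<sigma> * m\<close>.\<close>
    define Q where "Q = L - 2 * K * \<sigma>"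
    have Q: "Q > 0" using P mult_nonneg_nonpos[OF K0, of \<sigma>] neg by (simp add: Q_def)
    define \<epsilon> where "\<epsilon> = - \<sigma> * m / (2 * Q)"
    have \<epsilon>: "\<epsilon> > 0" using mult_neg_pos[OF neg m] Q by (simp add: \<epsilon>_def divide_neg_pos)
    have "compact (cylinder L :: 'n point set)" unfolding cylinder_def by (intro compact_Times) auto
    moreover have "continuous_on (cylinder L) (\<lambda>z::'n point. \<psi> (fst z))"
      by (rule continuous_on_compose2[OF \<psi>c]) (auto intro!: continuous_intros simp: cylinder_def)
    then have "continuous_on (cylinder L) (\<lambda>z. s * f z + \<epsilon> * \<psi> (fst z))"
      using fc by (intro continuous_intros)
    ultimately obtain z0 where z0: "z0 \<in> cylinder L"
      "\<forall>z\<in>cylinder L. s * f z + \<epsilon> * \<psi> (fst z) \<le> s * f z0 + \<epsilon> * \<psi> (fst z0)"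
      using continuous_attains_sup[of "cylinder L" "\<lambda>z. s * f z + \<epsilon> * \<psi> (fst z)"] z1(1) by blast
    have "\<sigma> * (s * f z0) \<le> \<sigma> * (m - 2 * K * \<epsilon>)"
      using key[OF \<epsilon> z0] neg by (intro mult_left_mono_neg) auto
    then have "\<sigma> * m + \<epsilon> * Q \<ge> 0" using key[OF \<epsilon> z0] by (simp add: Q_def algebra_simps)
    moreover have "\<epsilon> * Q = - \<sigma> * m / 2" using Q by (simp add: \<epsilon>_def)
    ultimately have "\<sigma> * m \<ge> 0" by simp
    then show False using mult_neg_pos[OF neg m] by simp
  qed
qed

subsection \<open>Upper bounds for the first eigenvalue\<close>

text \<open>Monotonicity of the integral, phrased for antiderivatives.\<close>

lemma increment_ge:
  fixes F G :: "real \<Rightarrow> real"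
  assumes "s \<le> t" "\<And>x. x \<in> {s..t} \<Longrightarrow> (F has_real_derivative F' x) (at x)"
    "\<And>x. x \<in> {s..t} \<Longrightarrow> (G has_real_derivative G' x) (at x)" "\<And>x. x \<in> {s..t} \<Longrightarrow> G' x \<le> F' x"
  shows "G t - G s \<le> F t - F s"
proof -
  have "F s - G s \<le> F t - G t"
    using assms(2-4) by (intro DERIV_nonneg_imp_nondecreasing[OF assms(1)])
      (fastforce intro!: exI[of _ "F' x - G' x" for x] DERIV_diff)
  then show ?thesis by linarith
qed

lemma steklov_1_le_radial_bound:
  fixes g :: "'n::finite metric"
  assumes N: "CARD('n) \<ge> 3" and p: "profile l L r h" and g: "warp_metric L h g"
  shows "steklov L g 1 \<le> radial_bound (CARD('n)) (1 + L / 2)"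
proof -
  obtain m where m: "CARD('n) = Suc (Suc m)" "m > 0"
    using N by (metis Suc_le_D numeral_3_eq_3 zero_less_Suc Suc_le_mono)
  have P: "l < 0" "0 < L" "L < r" "h 0 = 1" "h L = 1" using p by (auto simp: profile_def)
  have "continuous_on {l..r} (\<lambda>t. 1 / h t ^ Suc m)"
    using p unfolding profile_def by (intro continuous_intros) force+
  then obtain b where b: "\<And>t. t \<in> {l<..<r} \<Longrightarrow> (b has_real_derivative 1 / h t ^ Suc m) (at t)"
    using antiderivative_on_open_interval by blast
  define X where "X = (1 + L / 2) ^ m"
  have X: "X > 1" unfolding X_def using P m by (intro one_less_power) auto
  have d: "((\<lambda>\<rho>. - 1 / (real m * \<rho> ^ m)) has_real_derivative 1 / \<rho> ^ Suc m) (at \<rho>)" if "\<rho> > 0" for \<rho>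
  proof -
    have "((\<lambda>\<rho>. (- 1 / real m) / \<rho> ^ m) has_real_derivative 1 / \<rho> ^ Suc m) (at \<rho>)"
      using DERIV_divide_power[of "\<lambda>_. - 1 / real m" 0 \<rho> m] that m by simp
    then show ?thesis by simp
  qed
  \<comment> \<open>The better upper bound for \<open>h\<close> changes at the middle, so the halves
    are treated separately. Each contributes at least \<open>Y\<close>, the integral of
    \<open>1 / \<rho> ^ Suc m\<close> from 1 to \<open>1 + L / 2\<close>.\<close>
  have "- 1 / (real m * (1 + L / 2) ^ m) - - 1 / (real m * (1 + 0) ^ m) \<le> b (L / 2) - b 0"
  proof (rule increment_ge)
    fix t assume t: "t \<in> {0..L / 2}"
    show "(b has_real_derivative 1 / h t ^ Suc m) (at t)" using b[of t] t P by simp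
    have i: "((\<lambda>t. 1 + t) has_real_derivative 1) (at t)" by (auto intro!: derivative_eq_intros)
    show "((\<lambda>t. - 1 / (real m * (1 + t) ^ m)) has_real_derivative 1 / (1 + t) ^ Suc m) (at t)"
      using DERIV_chain2[where f = "\<lambda>\<rho>. - 1 / (real m * \<rho> ^ m)" and g = "\<lambda>t. 1 + t", OF d i] t by simp
    show "1 / (1 + t) ^ Suc m \<le> 1 / h t ^ Suc m"
      using profile_le(1)[OF p, of t] profile_pos[OF p, of t] t P by (intro divide_left_mono power_mono) auto
  qed (use P in auto)
  moreover have "1 / (real m * (1 + (L - L)) ^ m) - 1 / (real m * (1 + (L - L / 2)) ^ m) \<le> b L - b (L / 2)"
  proof (rule increment_ge)
    fix t assume t: "t \<in> {L / 2..L}"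
    show "(b has_real_derivative 1 / h t ^ Suc m) (at t)" using b[of t] t P by simp
    have "((\<lambda>t. - (- 1 / (real m * (1 + (L - t)) ^ m))) has_real_derivative - (1 / (1 + (L - t)) ^ Suc m * (- 1))) (at t)"
      by (rule DERIV_minus, rule DERIV_chain2[where f = "\<lambda>\<rho>. - 1 / (real m * \<rho> ^ m)" and g = "\<lambda>t. 1 + (L - t)", OF d])
        (use t in \<open>auto intro!: derivative_eq_intros\<close>)
    then show "((\<lambda>t. 1 / (real m * (1 + (L - t)) ^ m)) has_real_derivative 1 / (1 + (L - t)) ^ Suc m) (at t)" by simp
    show "1 / (1 + (L - t)) ^ Suc m \<le> 1 / h t ^ Suc m"
      using profile_le(2)[OF p, of t] profile_pos[OF p, of t] t P by (intro divide_left_mono power_mono) auto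
  qed (use P in auto)
  moreover have "1 + (L - L / 2) = 1 + L / 2" by simp
  moreover define Y where "Y = 1 / real m - 1 / (real m * X)"
  ultimately have "Y \<le> b (L / 2) - b 0" "Y \<le> b L - b (L / 2)"
    by (simp_all add: X_def)
  then have I: "2 * Y \<le> b L - b 0" by linarith
  define I where "I = b L - b 0"
  have e: "2 * Y = 2 * (X - 1) / (real m * X)"
    using m X by (simp add: Y_def field_simps)
  have pos: "2 * (X - 1) / (real m * X) > 0" using m X by simp
  then have Ip: "I > 0" using I e by (simp add: I_def)
  \<comment> \<open>Centring makes the end values opposite, so that both boundary conditions hold
    with the same eigenvalue \<open>2 / I\<close>.\<close>
  define a where "a t = b t - (b 0 + b L) / 2" for t
  have a: "a 0 = - I / 2" "a L = I / 2" by (simp_all add: a_def I_def field_simps)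
  have ef: "steklov_eigenfunction L g (2 / I) (\<lambda>z. a (fst z))"
  proof (rule steklov_eigenfunction_radial[OF p g])
    show "(a has_real_derivative 1 / h t ^ (CARD('n) - 1)) (at t)" if "t \<in> {l<..<r}" for t
      using b[OF that] unfolding a_def[abs_def] m by (auto intro!: derivative_eq_intros)
  qed (use a Ip in auto)
  obtain k :: 'n where True by simp
  have "steklov L g 1 \<le> 2 / I"
  proof (rule steklov_1_le[OF steklov_eigenvalue_nonneg[OF p g] steklov_eigenfunction_const[OF p g] ef])
    show "(0, axis k 1) \<in> cylinder L" "(L, axis k 1) \<in> cylinder L"
      using P by (auto simp: cylinder_def norm_axis_1)
    show "a (fst (0, axis k 1)) \<noteq> a (fst (L, axis k 1))" using a Ip by simp
  qed
  also have "2 / I \<le> 2 / (2 * (X - 1) / (real m * X))"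
    by (rule frac_le) (use I e pos in \<open>auto simp: I_def\<close>)
  also have "\<dots> = real m * X / (X - 1)" using X m(2) by (simp add: field_simps)
  also have "\<dots> = radial_bound (CARD('n)) (1 + L / 2)" by (simp add: radial_bound_def m X_def)
  finally show ?thesis .
qed

text \<open>Dirichlet's principle without integrals: the derivative of the expression below is at least
  \<open>c h\<^sup>m (w - a)\<^sup>2 + (v - p)\<^sup>2 / H\<^sup>m\<^sup>+\<^sup>2\<close>.\<close>

lemma energy_comparison:
  fixes w v a p h H :: "real \<Rightarrow> real"
  assumes st: "s \<le> t"
    and w: "\<And>x. x \<in> {s..t} \<Longrightarrow> (w has_real_derivative v x / H x ^ (m + 2)) (at x)"
    and v: "\<And>x. x \<in> {s..t} \<Longrightarrow> (v has_real_derivative c * H x ^ m * w x) (at x)"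
    and a: "\<And>x. x \<in> {s..t} \<Longrightarrow> (a has_real_derivative p x / h x ^ (m + 2)) (at x)"
    and p: "\<And>x. x \<in> {s..t} \<Longrightarrow> (p has_real_derivative c * h x ^ m * a x) (at x)"
    and h: "\<And>x. x \<in> {s..t} \<Longrightarrow> 0 < h x \<and> h x \<le> H x" and c: "c \<ge> 0"
  shows "v s * w s - 2 * w s * p s + a s * p s \<le> v t * w t - 2 * w t * p t + a t * p t"
proof (rule DERIV_nonneg_imp_nondecreasing[OF st])
  fix x assume "s \<le> x" "x \<le> t"
  then have x: "x \<in> {s..t}" by simp
  define E where "E = v x * (v x / H x ^ (m + 2)) + c * H x ^ m * w x * w x
      - (2 * w x * (c * h x ^ m * a x) + 2 * (v x / H x ^ (m + 2)) * p x)
      + (a x * (c * h x ^ m * a x) + p x / h x ^ (m + 2) * p x)"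
  have D: "((\<lambda>x. v x * w x - 2 * w x * p x + a x * p x) has_real_derivative E) (at x)"
    unfolding E_def using w[OF x] v[OF x] a[OF x] p[OF x] by (auto intro!: derivative_eq_intros)
  have hp: "0 < h x ^ (m + 2)" "h x ^ (m + 2) \<le> H x ^ (m + 2)" "h x ^ m \<le> H x ^ m" "0 < h x ^ m"
    using h[OF x] by (auto intro!: power_mono simp del: power_Suc)
  \<comment> \<open>Enlarging the profile raises the potential term and lowers the flux term. Hence
    the squares are completed with \<open>h\<close> in the former and \<open>H\<close> in the
    latter.\<close>
  have "p x * p x / H x ^ (m + 2) \<le> p x * p x / h x ^ (m + 2)"
    using hp by (intro divide_left_mono) (auto simp del: power_Suc intro: mult_pos_pos)
  moreover have "c * h x ^ m * (w x * w x) \<le> c * H x ^ m * (w x * w x)"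
    using hp c by (intro mult_right_mono mult_left_mono) auto
  moreover have "0 \<le> c * h x ^ m * (w x - a x)\<^sup>2 + (v x - p x)\<^sup>2 / H x ^ (m + 2)"
    using hp c by (intro add_nonneg_nonneg mult_nonneg_nonneg divide_nonneg_nonneg) auto
  ultimately have "0 \<le> E"
    unfolding E_def by (simp add: power2_eq_square algebra_simps add_divide_distrib diff_divide_distrib del: power_Suc)
  with D show "\<exists>y. ((\<lambda>x. v x * w x - 2 * w x * p x + a x * p x) has_real_derivative y) (at x) \<and> 0 \<le> y"
    by blast
qed

text \<open>The product \<open>a * p\<close> starts at 0 and never decreases, so
  \<open>a * a\<close> is nondecreasing; once positive, \<open>a\<close> cannot return to 0. This
  makes the boundary value problem for the modes solvable.\<close>

lemma shooting_positive:
  fixes a p \<alpha> \<beta> :: "real \<Rightarrow> real"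
  assumes L: "L > 0" and a: "\<And>t. t \<in> {0..L} \<Longrightarrow> (a has_real_derivative \<alpha> t * p t) (at t)"
    and p: "\<And>t. t \<in> {0..L} \<Longrightarrow> (p has_real_derivative \<beta> t * a t) (at t)"
    and nn: "\<And>t. t \<in> {0..L} \<Longrightarrow> 0 < \<alpha> t \<and> 0 \<le> \<beta> t" and ini: "a 0 = 0" "p 0 = 1"
  shows "a L > 0"
proof (rule ccontr)
  assume neg: "\<not> a L > 0"
  have ap: "0 \<le> a t * p t" if t: "t \<in> {0..L}" for t
  proof -
    have "a 0 * p 0 \<le> a t * p t"
    proof (rule DERIV_nonneg_imp_nondecreasing[of 0 t "\<lambda>t. a t * p t"])
      fix s assume "0 \<le> s" "s \<le> t"
      then have s: "s \<in> {0..L}" using t by simp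
      have "((\<lambda>t. a t * p t) has_real_derivative \<alpha> s * (p s * p s) + \<beta> s * (a s * a s)) (at s)"
        using a[OF s] p[OF s] by (auto intro!: derivative_eq_intros simp: algebra_simps)
      moreover have "0 \<le> \<alpha> s * (p s * p s) + \<beta> s * (a s * a s)"
        using nn[OF s] mult_nonneg_nonneg[of "\<alpha> s" "p s * p s"] mult_nonneg_nonneg[of "\<beta> s" "a s * a s"] by simp
      ultimately show "\<exists>y. ((\<lambda>t. a t * p t) has_real_derivative y) (at s) \<and> 0 \<le> y" by blast
    qed (use t in auto)
    then show ?thesis using ini by simp
  qed
  have mono: "a s * a s \<le> a t * a t" if "0 \<le> s" "s \<le> t" "t \<le> L" for s t
  proof (rule DERIV_nonneg_imp_nondecreasing[of s t "\<lambda>t. a t * a t"])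
    fix x assume "s \<le> x" "x \<le> t"
    then have x: "x \<in> {0..L}" using that by simp
    have "((\<lambda>t. a t * a t) has_real_derivative 2 * \<alpha> x * (a x * p x)) (at x)"
      using a[OF x] by (auto intro!: derivative_eq_intros simp: algebra_simps)
    moreover have "0 \<le> 2 * \<alpha> x * (a x * p x)"
      using nn[OF x] mult_nonneg_nonneg[of "2 * \<alpha> x" "a x * p x"] ap[OF x] by simp
    ultimately show "\<exists>y. ((\<lambda>t. a t * a t) has_real_derivative y) (at x) \<and> 0 \<le> y" by blast
  qed (use that in auto)
  have "\<alpha> 0 * p 0 > 0" using nn[of 0] L ini by simp
  then obtain d where d: "d > 0" "\<And>s. 0 < s \<Longrightarrow> s < d \<Longrightarrow> a 0 < a (0 + s)"
    using DERIV_pos_inc_right[OF a[of 0]] L by auto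
  define s where "s = min d L / 2"
  have s: "0 < s" "s < d" "s < L" using d L by (auto simp: s_def min_def)
  then have as: "a s > 0" using d(2)[of s] ini by simp
  have "continuous_on {s..L} a"
    using s by (intro continuous_at_imp_continuous_on) (auto intro!: DERIV_isCont[OF a])
  then obtain t where t: "s \<le> t" "t \<le> L" "a t = 0"
    using IVT2'[of a L 0 s] neg as s by auto
  have "a s * a s \<le> a t * a t" by (rule mono) (use s t in auto)
  then show False using as t(3) mult_pos_pos[OF as as] by simp
qed

text \<open>In the mode \<open>a(r) v\<^sub>k\<close> the Dirichlet-to-Neumann map is a symmetric \<open>2 \<times> 2\<close> matrix with entries in terms of
  the fundamental solutions; \<open>\<sigma>\<close> below is its smaller eigenvalue.\<close>

lemma smaller_root_bound:
  fixes A P Q R G :: real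
  assumes W: "A * R - P * Q = 1" and P: "P > 0" and G: "(R + A - 2) / P \<le> 2 * G"
  shows "\<exists>\<sigma>. \<sigma> \<le> G \<and> Q - \<sigma> * R = \<sigma> * (A - \<sigma> * P)"
proof -
  \<comment> \<open>By \<open>W\<close> the discriminant of
    \<open>P * \<sigma>\<^sup>2 - (R + A) * \<sigma> + Q\<close> is
    \<open>(A - R)\<^sup>2 + 4\<close>. The bound \<open>S \<ge> 2\<close> amounts to testing the
    symmetric matrix with equal boundary values, and is sharp when \<open>A = R\<close>.\<close>
  define S where "S = sqrt ((A - R)\<^sup>2 + 4)"
  have S2: "S\<^sup>2 = (A - R)\<^sup>2 + 4" by (simp add: S_def)
  have "S \<ge> sqrt 4" unfolding S_def by (intro real_sqrt_le_mono) simp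
  then have S: "S \<ge> 2" by simp
  define \<sigma> where "\<sigma> = (R + A - S) / (2 * P)"
  have "\<sigma> \<le> (R + A - 2) / (2 * P)" unfolding \<sigma>_def using S P by (intro divide_right_mono) auto
  then have "\<sigma> \<le> G" using G by simp
  moreover have "Q - \<sigma> * R = \<sigma> * (A - \<sigma> * P)"
  proof -
    have \<sigma>: "2 * P * \<sigma> = R + A - S" using P by (simp add: \<sigma>_def)
    have "(2 * P * \<sigma> - (R + A))\<^sup>2 = (A - R)\<^sup>2 + 4" unfolding \<sigma> using S2 by (simp add: power2_eq_square algebra_simps)
    then have "4 * P * (P * \<sigma>\<^sup>2 - (R + A) * \<sigma>) + (R + A)\<^sup>2 - (A - R)\<^sup>2 - 4 * 1 = 0"
      by (simp add: power2_eq_square algebra_simps)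
    then have "4 * P * (P * \<sigma>\<^sup>2 - (R + A) * \<sigma> + Q) = 0"
      unfolding W[symmetric] by (simp add: power2_eq_square algebra_simps)
    then have "P * \<sigma>\<^sup>2 - (R + A) * \<sigma> + Q = 0" using P by simp
    then show ?thesis by (simp add: power2_eq_square algebra_simps)
  qed
  ultimately show ?thesis by blast
qed

text \<open>\<open>p L - p 0\<close> is the energy of the mode with boundary value 1 at both ends.
  The competitor is the solution for the extremal profile, even about the middle, and each half of
  it contributes \<open>mode_bound\<close>.\<close>

lemma dirichlet_flux_bound:
  fixes a p h :: "real \<Rightarrow> real"
  assumes pr: "profile l L r h"
    and a: "\<And>t. t \<in> {l<..<r} \<Longrightarrow> (a has_real_derivative p t / h t ^ (m + 2)) (at t)"
    and p: "\<And>t. t \<in> {l<..<r} \<Longrightarrow> (p has_real_derivative (real m + 2) * h t ^ m * a t) (at t)"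
    and bc: "a 0 = 1" "a L = 1"
  shows "p L - p 0 \<le> 2 * mode_bound (m + 3) (1 + L / 2)"
proof -
  have P: "l < 0" "0 < L" "L < r" "h 0 = 1" "h L = 1" using pr by (auto simp: profile_def)
  define x where "x = 1 + L / 2"
  have x: "x > 1" using P by (simp add: x_def)
  define c where "c = x ^ (m + 3) / (real m + 2)"
  have c: "c > 0" using x by (simp add: c_def)
  then have c1: "1 + c \<noteq> 0" by simp
  \<comment> \<open>\<open>W\<close> is the radial factor of a harmonic function on the Euclidean annulus \<open>1 < \<rho> < x\<close>,
    with vanishing flux \<open>V\<close> at the middle of the cylinder.\<close>
  define W where "W \<rho> = (\<rho> + c / \<rho> ^ (m + 2)) / (1 + c)" for \<rho>
  define V where "V \<rho> = (\<rho> ^ (m + 2) - x ^ (m + 3) / \<rho> ^ 1) / (1 + c)" for \<rho>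
  have cx: "c * (real m + 2) = x ^ (m + 3)" by (simp add: c_def)
  have W': "(W has_real_derivative V \<rho> / \<rho> ^ (m + 2)) (at \<rho>)" if "\<rho> > 0" for \<rho>
  proof -
    have "(W has_real_derivative (1 + (0 / \<rho> ^ (m + 2) - real (m + 2) * c / \<rho> ^ Suc (m + 2))) / (1 + c)) (at \<rho>)"
      unfolding W_def[abs_def] using that
      by (intro DERIV_cdivide DERIV_add DERIV_ident DERIV_divide_power DERIV_const) auto
    moreover have "real (m + 2) * c = x ^ (m + 3)" using cx by (simp add: mult.commute add.commute)
    then have "(1 + (0 / \<rho> ^ (m + 2) - real (m + 2) * c / \<rho> ^ Suc (m + 2))) / (1 + c) = V \<rho> / \<rho> ^ (m + 2)"
      using that unfolding V_def by (simp add: field_simps)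
    ultimately show ?thesis by simp
  qed
  have V': "(V has_real_derivative (real m + 2) * \<rho> ^ m * W \<rho>) (at \<rho>)" if "\<rho> > 0" for \<rho>
  proof -
    have "(V has_real_derivative (real (m + 2) * \<rho> ^ (m + 2 - Suc 0)
        - (0 / \<rho> ^ 1 - real 1 * x ^ (m + 3) / \<rho> ^ Suc 1)) / (1 + c)) (at \<rho>)"
      unfolding V_def[abs_def] using that
      by (intro DERIV_cdivide DERIV_diff DERIV_pow DERIV_divide_power DERIV_const) auto
    moreover have "real (m + 2) * \<rho> ^ (m + 2 - Suc 0)
        - (0 / \<rho> ^ 1 - real 1 * x ^ (m + 3) / \<rho> ^ Suc 1) = (real m + 2) * \<rho> ^ m * (\<rho> + c / \<rho> ^ (m + 2))"
      using that unfolding cx[symmetric] by (simp add: field_simps)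
    then have "(real (m + 2) * \<rho> ^ (m + 2 - Suc 0)
        - (0 / \<rho> ^ 1 - real 1 * x ^ (m + 3) / \<rho> ^ Suc 1)) / (1 + c) = (real m + 2) * \<rho> ^ m * W \<rho>"
      unfolding W_def by simp
    ultimately show ?thesis by simp
  qed
  define G where "G = mode_bound (m + 3) x"
  have ends: "W 1 = 1" "V x = 0" "V 1 = - G"
  proof -
    show "W 1 = 1" using c1 by (simp add: W_def)
    have "x ^ (m + 3) / x = x ^ (m + 2)" using x by (simp add: numeral_eq_Suc)
    then show "V x = 0" by (simp add: V_def)
    have xp: "x ^ (m + 3) > 0" using x by simp
    have c1': "1 + c = (x ^ (m + 3) + real m + 2) / (real m + 2)" by (simp add: c_def field_simps)
    show "V 1 = - G" unfolding V_def G_def mode_bound_def c1' by (simp add: algebra_simps minus_divide_left)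
  qed
  have A: "V (1 + 0) * W (1 + 0) - 2 * W (1 + 0) * p 0 + a 0 * p 0
      \<le> V (1 + L / 2) * W (1 + L / 2) - 2 * W (1 + L / 2) * p (L / 2) + a (L / 2) * p (L / 2)"
  proof (rule energy_comparison[where H = "\<lambda>t. 1 + t" and h = h and m = m and c = "real m + 2"])
    fix t assume t: "t \<in> {0..L / 2}"
    have i: "((\<lambda>t. 1 + t) has_real_derivative 1) (at t)" by (auto intro!: derivative_eq_intros)
    show "((\<lambda>t. W (1 + t)) has_real_derivative V (1 + t) / (1 + t) ^ (m + 2)) (at t)"
      using DERIV_chain2[where f = W and g = "\<lambda>t. 1 + t", OF W' i] t by simp
    show "((\<lambda>t. V (1 + t)) has_real_derivative (real m + 2) * (1 + t) ^ m * W (1 + t)) (at t)"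
      using DERIV_chain2[where f = V and g = "\<lambda>t. 1 + t", OF V' i] t by simp
    show "0 < h t \<and> h t \<le> 1 + t" using profile_pos[OF pr, of t] profile_le(1)[OF pr, of t] t P by simp
  qed (use P a p in auto)
  \<comment> \<open>On the second half the annulus is traversed inwards, so the flux of the
    competitor changes sign.\<close>
  have B: "(- V (1 + (L - L / 2))) * W (1 + (L - L / 2)) - 2 * W (1 + (L - L / 2)) * p (L / 2) + a (L / 2) * p (L / 2)
      \<le> (- V (1 + (L - L))) * W (1 + (L - L)) - 2 * W (1 + (L - L)) * p L + a L * p L"
  proof (rule energy_comparison[where H = "\<lambda>t. 1 + (L - t)" and h = h and m = m and c = "real m + 2"])
    fix t assume t: "t \<in> {L / 2..L}"
    then have pos: "1 + (L - t) > 0" by simp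
    have i: "((\<lambda>t. 1 + (L - t)) has_real_derivative - 1) (at t)" by (auto intro!: derivative_eq_intros)
    show "((\<lambda>t. W (1 + (L - t))) has_real_derivative (- V (1 + (L - t))) / (1 + (L - t)) ^ (m + 2)) (at t)"
      using DERIV_chain2[where f = W and g = "\<lambda>t. 1 + (L - t)", OF W'[OF pos] i] by simp
    show "((\<lambda>t. - V (1 + (L - t))) has_real_derivative (real m + 2) * (1 + (L - t)) ^ m * W (1 + (L - t))) (at t)"
      using DERIV_minus[OF DERIV_chain2[where f = V and g = "\<lambda>t. 1 + (L - t)", OF V'[OF pos] i]] by simp
    show "0 < h t \<and> h t \<le> 1 + (L - t)" using profile_pos[OF pr, of t] profile_le(2)[OF pr, of t] t P by simp
  qed (use P a p in auto)
  \<comment> \<open>At the middle the competitor has no flux and the same value from both sides, so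
    the middle terms of \<open>A\<close> and \<open>B\<close> coincide and cancel on adding.\<close>
  have "1 + (L - L / 2) = x" by (simp add: x_def)
  then show ?thesis using A B ends bc unfolding x_def[symmetric] by (simp add: G_def)
qed

text \<open>With fundamental solutions \<open>u\<close> and \<open>v\<close>, the combination
  \<open>u - \<sigma> v\<close> meets the Steklov condition at 0 for every \<sigma>; the condition
  at \<open>L\<close> is then the quadratic of \<open>smaller_root_bound\<close>.\<close>

lemma steklov_1_le_mode_bound:
  fixes g :: "'n::finite metric"
  assumes N: "CARD('n) \<ge> 3" and pr: "profile l L r h" and g: "warp_metric L h g"
  shows "steklov L g 1 \<le> mode_bound (CARD('n)) (1 + L / 2)"
proof -
  obtain m where m: "CARD('n) = m + 3" using N by (metis le_add_diff_inverse2)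
  have P: "l < 0" "0 < L" "L < r" "h 0 = 1" "h L = 1" using pr by (auto simp: profile_def)
  define \<alpha> where "\<alpha> t = 1 / h t ^ (m + 2)" for t
  define \<beta> where "\<beta> t = (real m + 2) * h t ^ m" for t
  have cont: "continuous_on {l..r} \<alpha>" "continuous_on {l..r} \<beta>"
    using pr unfolding profile_def \<alpha>_def \<beta>_def by (intro continuous_intros; force)+
  have "0 < r" using P by simp
  note ex = linear_system_on_interval[OF cont P(1) this]
  obtain u pu where u: "u 0 = 1" "pu 0 = 0"
    "\<And>t. t \<in> {l<..<r} \<Longrightarrow> (u has_real_derivative \<alpha> t * pu t) (at t)"
    "\<And>t. t \<in> {l<..<r} \<Longrightarrow> (pu has_real_derivative \<beta> t * u t) (at t)" using ex[of 1 0] by blast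
  obtain v pv where v: "v 0 = 0" "pv 0 = 1"
    "\<And>t. t \<in> {l<..<r} \<Longrightarrow> (v has_real_derivative \<alpha> t * pv t) (at t)"
    "\<And>t. t \<in> {l<..<r} \<Longrightarrow> (pv has_real_derivative \<beta> t * v t) (at t)" using ex[of 0 1] by blast
  have comb: "((\<lambda>t. u t + \<kappa> * v t) has_real_derivative \<alpha> t * (pu t + \<kappa> * pv t)) (at t)"
    "((\<lambda>t. pu t + \<kappa> * pv t) has_real_derivative \<beta> t * (u t + \<kappa> * v t)) (at t)"
    if "t \<in> {l<..<r}" for t \<kappa>
    using u(3)[OF that] u(4)[OF that] v(3)[OF that] v(4)[OF that]
    by (auto intro!: derivative_eq_intros simp: algebra_simps)
  have wronskian: "u L * pv L - v L * pu L = 1"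
  proof -
    have D: "((\<lambda>t. u t * pv t - v t * pu t) has_real_derivative 0) (at t)" if "t \<in> {0..L}" for t
    proof -
      have "t \<in> {l<..<r}" using that P by auto
      then show ?thesis using u(3,4)[of t] v(3,4)[of t]
        by (auto intro!: derivative_eq_intros simp: algebra_simps)
    qed
    then have "(\<lambda>t. u t * pv t - v t * pu t) L = (\<lambda>t. u t * pv t - v t * pu t) 0"
      using P by (intro DERIV_isconst_end[of 0 L] continuous_at_imp_continuous_on) (auto intro: DERIV_isCont[OF D])
    then show ?thesis using u v by simp
  qed
  have vL: "v L > 0"
    by (rule shooting_positive[where \<alpha> = \<alpha> and \<beta> = \<beta> and p = pv])
      (use P v profile_pos[OF pr] in \<open>auto simp: \<alpha>_def \<beta>_def intro!: mult_nonneg_nonneg less_imp_le\<close>)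
  \<comment> \<open>\<open>u + \<kappa> v\<close> takes the value 1 at both ends, as
    \<open>dirichlet_flux_bound\<close> requires; the Wronskian then rewrites its flux difference as
    \<open>(pv L + u L - 2) / v L\<close>.\<close>
  define \<kappa> where "\<kappa> = (1 - u L) / v L"
  define G where "G = mode_bound (CARD('n)) (1 + L / 2)"
  have "(pu L + \<kappa> * pv L) - (pu 0 + \<kappa> * pv 0) \<le> 2 * G"
    unfolding G_def m
    by (rule dirichlet_flux_bound[OF pr, where a = "\<lambda>t. u t + \<kappa> * v t"])
      (use comb[of _ \<kappa>] u v vL in \<open>auto simp: \<alpha>_def \<beta>_def \<kappa>_def\<close>)
  moreover have "(pu L + \<kappa> * pv L) - (pu 0 + \<kappa> * pv 0) = (pv L + u L - 2) / v L"
  proof -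
    have "(pu L + \<kappa> * pv L) - (pu 0 + \<kappa> * pv 0) = (v L * pu L + (1 - u L) * pv L - (1 - u L)) / v L"
      using vL u v by (simp add: \<kappa>_def field_simps)
    also have "v L * pu L = u L * pv L - 1" using wronskian by simp
    finally show ?thesis by (simp add: algebra_simps)
  qed
  ultimately obtain \<sigma> where \<sigma>: "\<sigma> \<le> G" "pu L - \<sigma> * pv L = \<sigma> * (u L - \<sigma> * v L)"
    using smaller_root_bound[of "u L" "pv L" "v L" "pu L" G] wronskian vL by auto
  obtain k :: 'n where True by simp
  have "steklov_eigenfunction L g \<sigma> (\<lambda>z. (u (fst z) + (- \<sigma>) * v (fst z)) * snd z $ k)"
    by (rule steklov_eigenfunction_mode[OF pr g N, where a = "\<lambda>t. u t + (- \<sigma>) * v t" and q = "\<lambda>t. pu t + (- \<sigma>) * pv t"])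
      (use comb[of _ "- \<sigma>"] u v \<sigma>(2) in \<open>auto simp: \<alpha>_def \<beta>_def m add.commute\<close>)
  \<comment> \<open>The witnesses are antipodal points over \<open>r = 0\<close>, where the mode
    takes the values 1 and -1.\<close>
  from steklov_1_le[OF steklov_eigenvalue_nonneg[OF pr g] steklov_eigenfunction_const[OF pr g] this,
      where z = "(0, axis k 1)" and w = "(0, - axis k 1)"]
  have "steklov L g 1 \<le> \<sigma>"
    using P u v by (simp add: cylinder_def norm_axis_1 axis_1_nth)
  then show ?thesis using \<sigma>(1) by (simp add: G_def)
qed

theorem theorem6:
  fixes n :: nat
  assumes "n = CARD('n::finite)" and "n \<ge> 3"
  shows
    "(\<forall>L>0. L \<noteq> L1 n \<longrightarrow>
        (\<exists>C>0. \<forall>g :: 'n metric. metric_of_revolution L g \<longrightarrow> B n - steklov L g 1 \<ge> C))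
     \<and>
     (\<exists>C>0. \<forall>L>0. L \<noteq> L1 n \<longrightarrow>
        (\<forall>g :: 'n metric. metric_of_revolution L g \<longrightarrow>
           (\<forall>\<delta>. 0 < \<delta> \<and> \<delta> < (B n - (real n - 2)) / 2 \<longrightarrow>
              \<bar>B n - steklov L g 1\<bar> < \<delta> \<longrightarrow> \<bar>L1 n - L\<bar> < C * \<delta>)))"
proof (rule stability_from_bounds[OF assms(2)])
  fix L :: real and g :: "'n metric"
  assume "L > 0" "metric_of_revolution L g"
  then obtain h l r where "profile l L r h" "warp_metric L h g"
    using metric_of_revolution_profile by blast
  then show "steklov L g 1 \<le> radial_bound n (1 + L / 2)" "steklov L g 1 \<le> mode_bound n (1 + L / 2)"
    using steklov_1_le_radial_bound[of l L r h g] steklov_1_le_mode_bound[of l L r h g] assms by auto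
qed

end
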